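(* Let $n,p\ge 0$ be integers, not both zero. On $S^{2n+1}\times S^{2p+1}=U(n+1)/U(n)\times U(p+1)/U(p)$ consider, for real parameters $a$ and $c>0$, the $U(n+1)\times U(p+1)$-invariant complex structures $I(a,c)$ and the $U(n+1)\times U(p+1)$-invariant $I(a,c)$-Hermitian metrics $g(a,c)$. (1) If $n=0$ or $p=0$, then for no $a\in\mathbb{R}$, $c>0$ is the Ricci tensor of $g(a,c)$ Hermitian with respect to $I(a,c)$. (2) If $n\neq 0$ and $p\neq 0$, then for $a=0$ and $c=\sqrt{n/p}$ the metric $g(a,c)$ has $I(a,c)$-Hermitian Ricci tensor.
   Context: Setting. Throughout, $n,p\ge 0$ are integers, not both zero. Write $\mathfrak{g}_1=\mathfrak{u}(n+1)$, $\mathfrak{h}_1=\mathfrak{u}(n)$, $\mathfrak{g}_2=\mathfrak{u}(p+1)$, $\mathfrak{h}_2=\mathfrak{u}(p)$, where $\mathfrak{h}_j\subset\mathfrak{g}_j$ is embedded as the lower right block $M\mapsto\begin{pmatrix}0&0\\0&M\end{pmatrix}$ (the groups $U(n)\subset U(n+1)$, $U(p)\subset U(p+1)$ are embedded correspondingly). Matrix rows and columns are indexed from $0$. Let $E^j_{\nu\mu}$ be the matrix (of the size of matrices in $\mathfrak{g}_j$) with $1$ in position $(\nu,\mu)$ and zeros elsewhere, and put $Z^j_{\nu\mu}=E^j_{\nu\mu}-E^j_{\mu\nu}$, $T^j_{\nu\mu}=E^j_{\nu\mu}+E^j_{\mu\nu}$. Define $$X^j=\tfrac12 iT^j_{00},\quad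 Y^j_{2\nu-1}=Z^j_{\nu0},\quad Y^j_{2\nu}=iT^j_{\nu0},$$ with $1\le\nu\le n$ for $j=1$ and $1\le\nu\le p$ for $j=2$ (superscripts are labels, not powers). Let $\mathfrak{p}_j$ be the real span of $X^j$ and the $Y^j_k$; then $\mathfrak{g}_j=\mathfrak{h}_j\oplus\mathfrak{p}_j$ is a reductive decomposition. Put $\mathfrak{p}=\mathfrak{p}_1\times\mathfrak{p}_2$ and $\mathfrak{h}=\mathfrak{h}_1\times\mathfrak{h}_2$. The tangent space of $U(n+1)/U(n)\times U(p+1)/U(p)\cong S^{2n+1}\times S^{2p+1}$ at the base point is identified with $\mathfrak{p}$, and invariant tensor fields are identified with the corresponding $\mathrm{Ad}(U(n)\times U(p))$-invariant tensors on $\mathfrak{p}$. For $a\in\mathbb{R}$, $c>0$ the invariant complex structure $I(a,c)$ is given on $\mathfrak{p}$ by $$I(a,c)X^1=\tfrac{a}{c}X^1+\tfrac1cX^2,\quad I(a,c)X^2=-\tfrac{a^2+c^2}{c}X^1-\tfrac{a}{c}X^2,$$ $$I(a,c)Y^1_{2\nu-1}=Y^1_{2\nu},\quad I(a,c)Y^2_{2\mu-1}=Y^2_{2\mu}\qquad(1\le\nu\le n,\ 1\le\mu\le p),$$ (and hence $I(a,c)Y^j_{2\nu}=-Y^j_{2\nu-1}$). The invariant Riemannian metric $g(a,c)$ is given on $\mathfrak{p}$ by $$g(a,c)(X^1,X^1)=\tfrac1c,\quad g(a,c)(X^2,X^2)=\tfrac{a^2+c^2}{c},\quad g(a,c)(X^1,X^2)=-\tfrac{a}{c},$$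 $$g(a,c)(Y^1_j,Y^1_j)=g(a,c)(Y^2_k,Y^2_k)=1\quad(1\le j\le2n,\ 1\le k\le2p),$$ and $g(a,c)(X,Y)=0$ for all other pairs of basis vectors. A symmetric bilinear tensor $Ric$ is called $I$-Hermitian if $Ric(IX,IY)=Ric(X,Y)$ for all tangent vectors $X,Y$. *)

theory Defs
  imports "HOL-Analysis.Analysis"
begin

section \<open>Riemannian geometry of submanifolds of a Euclidean space\<close>

primrec Ck :: "nat \<Rightarrow> ('a::euclidean_space \<Rightarrow> 'b::euclidean_space) \<Rightarrow> bool" where
  "Ck 0 f \<longleftrightarrow> continuous_on UNIV f"
| "Ck (Suc k) f \<longleftrightarrow>
     (\<forall>x. f differentiable (at x)) \<and> (\<forall>v. Ck k (\<lambda>x. frechet_derivative f (at x) v))"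

definition smooth :: "('a::euclidean_space \<Rightarrow> 'b::euclidean_space) \<Rightarrow> bool" where
  "smooth f \<longleftrightarrow> (\<forall>k. Ck k f)"

definition tangent_space :: "'a::euclidean_space set \<Rightarrow> 'a \<Rightarrow> 'a set" where
  "tangent_space M x =
     {v. \<exists>\<gamma>::real \<Rightarrow> 'a. (\<forall>t. \<gamma> t \<in> M) \<and> \<gamma> 0 = x \<and> (\<gamma> has_vector_derivative v) (at 0)}"

(* Vector fields on M are represented by smooth maps of the whole ambient space that are tangent
   to M along M; if M is closed, every smooth vector field on M is the restriction of such a map.
   Only the values on M are ever used, and all identities below are required on M only. *)
definition vector_fields :: "'a::euclidean_space set \<Rightarrow> ('a \<Rightarrow> 'a) set" where
  "vector_fields M = {X. smooth X \<and> (\<forall>x\<in>M. X x \<in> tangent_space M x)}"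

definition lie_bracket :: "('a::euclidean_space \<Rightarrow> 'a) \<Rightarrow> ('a \<Rightarrow> 'a) \<Rightarrow> 'a \<Rightarrow> 'a" where
  "lie_bracket X Y x = frechet_derivative Y (at x) (X x) - frechet_derivative X (at x) (Y x)"

definition affine_connection ::
  "'a::euclidean_space set \<Rightarrow> (('a \<Rightarrow> 'a) \<Rightarrow> ('a \<Rightarrow> 'a) \<Rightarrow> 'a \<Rightarrow> 'a) \<Rightarrow> bool" where
  "affine_connection M D \<longleftrightarrow>
     (\<forall>X\<in>vector_fields M. \<forall>Y\<in>vector_fields M. D X Y \<in> vector_fields M) \<and>
     (\<forall>X\<in>vector_fields M. \<forall>X'\<in>vector_fields M. \<forall>Y\<in>vector_fields M. \<forall>Y'\<in>vector_fields M.
        (\<forall>x\<in>M. X x = X' x \<and> Y x = Y' x) \<longrightarrow> (\<forall>x\<in>M. D X Y x = D X' Y' x)) \<and>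
     (\<forall>X\<in>vector_fields M. \<forall>X'\<in>vector_fields M. \<forall>Y\<in>vector_fields M. \<forall>x\<in>M.
        D (\<lambda>y. X y + X' y) Y x = D X Y x + D X' Y x) \<and>
     (\<forall>X\<in>vector_fields M. \<forall>Y\<in>vector_fields M. \<forall>Y'\<in>vector_fields M. \<forall>x\<in>M.
        D X (\<lambda>y. Y y + Y' y) x = D X Y x + D X Y' x) \<and>
     (\<forall>f::'a \<Rightarrow> real. smooth f \<longrightarrow>
        (\<forall>X\<in>vector_fields M. \<forall>Y\<in>vector_fields M. \<forall>x\<in>M.
           D (\<lambda>y. f y *\<^sub>R X y) Y x = f x *\<^sub>R D X Y x \<and>
           D X (\<lambda>y. f y *\<^sub>R Y y) x
             = f x *\<^sub>R D X Y x + frechet_derivative f (at x) (X x) *\<^sub>R Y x))"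

definition torsion_free ::
  "'a::euclidean_space set \<Rightarrow> (('a \<Rightarrow> 'a) \<Rightarrow> ('a \<Rightarrow> 'a) \<Rightarrow> 'a \<Rightarrow> 'a) \<Rightarrow> bool" where
  "torsion_free M D \<longleftrightarrow>
     (\<forall>X\<in>vector_fields M. \<forall>Y\<in>vector_fields M. \<forall>x\<in>M.
        D X Y x - D Y X x = lie_bracket X Y x)"

(* A metric g on M is a family of forms g x, meaningful for x in M and tangent vectors at x.
   The derivative of g(Y,Z) is therefore taken within M.  Such a derivative L is not unique as a
   linear map of the ambient space, but its value on the tangent vector X x is. *)
definition metric_compatible ::
  "'a::euclidean_space set \<Rightarrow> ('a \<Rightarrow> 'a \<Rightarrow> 'a \<Rightarrow> real) \<Rightarrow>
     (('a \<Rightarrow> 'a) \<Rightarrow> ('a \<Rightarrow> 'a) \<Rightarrow> 'a \<Rightarrow> 'a) \<Rightarrow> bool" where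
  "metric_compatible M g D \<longleftrightarrow>
     (\<forall>X\<in>vector_fields M. \<forall>Y\<in>vector_fields M. \<forall>Z\<in>vector_fields M. \<forall>x\<in>M.
        \<exists>L. ((\<lambda>y. g y (Y y) (Z y)) has_derivative L) (at x within M) \<and>
            L (X x) = g x (D X Y x) (Z x) + g x (Y x) (D X Z x))"

definition levi_civita ::
  "'a::euclidean_space set \<Rightarrow> ('a \<Rightarrow> 'a \<Rightarrow> 'a \<Rightarrow> real) \<Rightarrow>
     ('a \<Rightarrow> 'a) \<Rightarrow> ('a \<Rightarrow> 'a) \<Rightarrow> 'a \<Rightarrow> 'a" where
  "levi_civita M g =
     (SOME D. affine_connection M D \<and> torsion_free M D \<and> metric_compatible M g D)"

definition curvature ::
  "(('a::euclidean_space \<Rightarrow> 'a) \<Rightarrow> ('a \<Rightarrow> 'a) \<Rightarrow> 'a \<Rightarrow> 'a) \<Rightarrow>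
     ('a \<Rightarrow> 'a) \<Rightarrow> ('a \<Rightarrow> 'a) \<Rightarrow> ('a \<Rightarrow> 'a) \<Rightarrow> 'a \<Rightarrow> 'a" where
  "curvature D X Y Z x = D X (D Y Z) x - D Y (D X Z) x - D (lie_bracket X Y) Z x"

definition field_through :: "'a::euclidean_space set \<Rightarrow> 'a \<Rightarrow> 'a \<Rightarrow> 'a \<Rightarrow> 'a" where
  "field_through M x v = (SOME X. X \<in> vector_fields M \<and> X x = v)"

definition trace_on :: "'a::euclidean_space set \<Rightarrow> ('a \<Rightarrow> 'a) \<Rightarrow> real" where
  "trace_on V L =
     (let B = (SOME B. independent B \<and> span B = V) in \<Sum>b\<in>B. representation B (L b) b)"

definition ricci ::
  "'a::euclidean_space set \<Rightarrow> ('a \<Rightarrow> 'a \<Rightarrow> 'a \<Rightarrow> real) \<Rightarrow> 'a \<Rightarrow> 'a \<Rightarrow> 'a \<Rightarrow> real" where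
  "ricci M g x v w =
     trace_on (tangent_space M x)
       (\<lambda>u. curvature (levi_civita M g)
              (field_through M x u) (field_through M x v) (field_through M x w) x)"

definition hermitian_tensor ::
  "'a::euclidean_space set \<Rightarrow> ('a \<Rightarrow> 'a \<Rightarrow> 'a) \<Rightarrow> ('a \<Rightarrow> 'a \<Rightarrow> 'a \<Rightarrow> real) \<Rightarrow> bool" where
  "hermitian_tensor M I S \<longleftrightarrow>
     (\<forall>x\<in>M. \<forall>v\<in>tangent_space M x. \<forall>w\<in>tangent_space M x. S x (I x v) (I x w) = S x v w)"


section \<open>The Lie algebra data\<close>

(* Matrices of size n+1 are indexed by a finite type 'm with n+1 elements (for instance the
   numeral type n+1) whose element 0 is the first row and column; the positions 1,...,n are the
   elements of 'm other than 0. *)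

type_synonym 'm cvec = "(complex, 'm) vec"

type_synonym 'm cmat = "((complex, 'm) vec, 'm) vec"

definition mscale :: "complex \<Rightarrow> 'm::finite cmat \<Rightarrow> 'm cmat" where
  "mscale c A = map_matrix (\<lambda>z. c * z) A"

definition Emat :: "'m::finite \<Rightarrow> 'm \<Rightarrow> 'm cmat" where
  "Emat \<nu> \<mu> = (\<chi> r s. if r = \<nu> \<and> s = \<mu> then 1 else 0)"

definition Zmat :: "'m::finite \<Rightarrow> 'm \<Rightarrow> 'm cmat" where
  "Zmat \<nu> \<mu> = Emat \<nu> \<mu> - Emat \<mu> \<nu>"

definition Tmat :: "'m::finite \<Rightarrow> 'm \<Rightarrow> 'm cmat" where
  "Tmat \<nu> \<mu> = Emat \<nu> \<mu> + Emat \<mu> \<nu>"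

definition Xvec :: "'m::{finite,zero} cmat" where
  "Xvec = mscale (\<i> / 2) (Tmat 0 0)"

(* Yodd \<nu> and Yeven \<nu> are the vectors with the labels 2 \<nu> - 1 and 2 \<nu>, respectively. *)
definition Yodd :: "'m::{finite,zero} \<Rightarrow> 'm cmat" where
  "Yodd \<nu> = Zmat \<nu> 0"

definition Yeven :: "'m::{finite,zero} \<Rightarrow> 'm cmat" where
  "Yeven \<nu> = mscale \<i> (Tmat \<nu> 0)"

definition X1 :: "'m::{finite,zero} cmat \<times> 'k::{finite,zero} cmat" where
  "X1 = (Xvec, 0)"

definition X2 :: "'m::{finite,zero} cmat \<times> 'k::{finite,zero} cmat" where
  "X2 = (0, Xvec)"

definition Ys :: "('m::{finite,zero} cmat \<times> 'k::{finite,zero} cmat) set" where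
  "Ys = {(Yodd \<nu>, 0) | \<nu>. \<nu> \<noteq> 0} \<union> {(Yeven \<nu>, 0) | \<nu>. \<nu> \<noteq> 0} \<union>
        {(0, Yodd \<mu>) | \<mu>. \<mu> \<noteq> 0} \<union> {(0, Yeven \<mu>) | \<mu>. \<mu> \<noteq> 0}"

definition \<pp> :: "('m::{finite,zero} cmat \<times> 'k::{finite,zero} cmat) set" where
  "\<pp> = span ({X1, X2} \<union> Ys)"

(* I_p and g_p are defined on all pairs of matrices, but the conditions determine them on \<pp> only,
   and only their restrictions to \<pp> are used. *)
definition I_p :: "real \<Rightarrow> real \<Rightarrow> 'm::{finite,zero} cmat \<times> 'k::{finite,zero} cmat \<Rightarrow>
    'm cmat \<times> 'k cmat" where
  "I_p a c = (SOME I. linear I \<and>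
     I X1 = (a / c) *\<^sub>R X1 + (1 / c) *\<^sub>R X2 \<and>
     I X2 = (- (a\<^sup>2 + c\<^sup>2) / c) *\<^sub>R X1 - (a / c) *\<^sub>R X2 \<and>
     (\<forall>\<nu>. \<nu> \<noteq> 0 \<longrightarrow> I (Yodd \<nu>, 0) = (Yeven \<nu>, 0) \<and> I (Yeven \<nu>, 0) = - (Yodd \<nu>, 0)) \<and>
     (\<forall>\<mu>. \<mu> \<noteq> 0 \<longrightarrow> I (0, Yodd \<mu>) = (0, Yeven \<mu>) \<and> I (0, Yeven \<mu>) = - (0, Yodd \<mu>)))"

definition g_p :: "real \<Rightarrow> real \<Rightarrow> 'm::{finite,zero} cmat \<times> 'k::{finite,zero} cmat \<Rightarrow>
    'm cmat \<times> 'k cmat \<Rightarrow> real" where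
  "g_p a c = (SOME g. bilinear g \<and>
     g X1 X1 = 1 / c \<and> g X2 X2 = (a\<^sup>2 + c\<^sup>2) / c \<and> g X1 X2 = - a / c \<and> g X2 X1 = - a / c \<and>
     (\<forall>Y\<in>Ys. g X1 Y = 0 \<and> g Y X1 = 0 \<and> g X2 Y = 0 \<and> g Y X2 = 0) \<and>
     (\<forall>Y\<in>Ys. \<forall>Y'\<in>Ys. g Y Y' = (if Y = Y' then 1 else 0)))"


section \<open>Invariant tensor fields on the product of spheres\<close>

definition unitary_group :: "'m::finite cmat set" where
  "unitary_group = {U. transpose (map_matrix cnj U) ** U = mat 1}"

definition act :: "'m::finite cmat \<times> 'k::finite cmat \<Rightarrow>
    'm cvec \<times> 'k cvec \<Rightarrow> 'm cvec \<times> 'k cvec" where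
  "act A x = (fst A *v fst x, snd A *v snd x)"

definition base_point :: "'m::{finite,zero} cvec \<times> 'k::{finite,zero} cvec" where
  "base_point = (axis 0 1, axis 0 1)"

definition sphere_product :: "('m::finite cvec \<times> 'k::finite cvec) set" where
  "sphere_product = sphere 0 1 \<times> sphere 0 1"

(* The homogeneous space is the orbit of base_point under the product of unitary groups; the
   isotropy group consists of the pairs of lower right blocks.  An element A of \<pp> is identified
   with the velocity at t = 0 of exp (t A) base_point, that is, with act A base_point.  An element
   k of the group acts on the ambient space linearly, so that its differential is again act k.
   By Ad-invariance on \<pp> the values below do not depend on the choice of k. *)
definition cplx_structure :: "real \<Rightarrow> real \<Rightarrow>
    'm::{finite,zero} cvec \<times> 'k::{finite,zero} cvec \<Rightarrow>
    'm cvec \<times> 'k cvec \<Rightarrow> 'm cvec \<times> 'k cvec" where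
  "cplx_structure a c x v = (THE w. \<exists>k \<in> unitary_group \<times> unitary_group. \<exists>A\<in>\<pp>.
     x = act k base_point \<and> v = act k (act A base_point) \<and> w = act k (act (I_p a c A) base_point))"

definition inv_metric :: "real \<Rightarrow> real \<Rightarrow>
    'm::{finite,zero} cvec \<times> 'k::{finite,zero} cvec \<Rightarrow>
    'm cvec \<times> 'k cvec \<Rightarrow> 'm cvec \<times> 'k cvec \<Rightarrow> real" where
  "inv_metric a c x v w = (THE r. \<exists>k \<in> unitary_group \<times> unitary_group. \<exists>A\<in>\<pp>. \<exists>B\<in>\<pp>.
     x = act k base_point \<and> v = act k (act A base_point) \<and> w = act k (act B base_point) \<and>
     r = g_p a c A B)"

end

theory Submission
  imports Defs
begin

text \<open>Write \<open>x\<^sub>i\<close> for the two components of a point and \<open>\<eta>\<^sub>i\<close> for the contact form dual to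
  the Hopf field \<open>J x\<^sub>i\<close>.  The metric \<open>g(a,c)\<close> is the round product metric plus
  \<open>\<Sum>k\<^sub>i\<^sub>j \<eta>\<^sub>i \<eta>\<^sub>j\<close>, so its Levi-Civita connection is the flat one plus a tensor
  \<open>\<Gamma>\<close> that is polynomial in the point.  Contracting the curvature, with
  \<open>\<theta>\<^sub>i = \<Sum>k\<^sub>i\<^sub>j \<eta>\<^sub>j\<close> and \<open>d\<^sub>i\<close> the real dimension of the \<open>i\<close>-th ambient space, gives
  \<open>Ric(v,w) = \<Sum>(d\<^sub>i - 2) (\<eta>\<^sub>i + \<theta>\<^sub>i)(v) (\<eta>\<^sub>i + \<theta>\<^sub>i)(w) + (d\<^sub>i - 2 - 2 k\<^sub>i\<^sub>i) q\<^sub>i(v,w)\<close>,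
  where \<open>q\<^sub>i\<close> is the round metric on the horizontal vectors of the \<open>i\<close>-th sphere.  The \<open>q\<^sub>i\<close> are always
  \<open>I(a,c)\<close>-Hermitian.  If one \<open>d\<^sub>i\<close> is \<open>2\<close>, then Ric has rank one on the plane spanned by the Hopf fields
  and cannot be Hermitian there.  If \<open>a = 0\<close>, it is Hermitian on this plane iff \<open>n = c\<^sup>2 p\<close>.\<close>

section \<open>Smooth maps\<close>

abbreviation fd :: "('a::euclidean_space \<Rightarrow> 'b::euclidean_space) \<Rightarrow> 'a \<Rightarrow> 'a \<Rightarrow> 'b" where
  "fd f x \<equiv> frechet_derivative f (at x)"

lemma has_derivative_fd:
  "f differentiable (at x) \<Longrightarrow> (f has_derivative fd f x) (at x within S)"
  by (metis frechet_derivative_works has_derivative_at_withinI)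

lemma fd_eq: "(f has_derivative L) (at x) \<Longrightarrow> fd f x = L"
  by (rule frechet_derivative_at[symmetric])

text \<open>At level \<open>Suc k\<close> the recursion asks for differentiability of
  \<open>f\<close> and regularity of its directional derivatives; continuity enters at the bottom
  and induction carries it up. The product rule in \<open>Ck_bilinear\<close> relies on this, since
  it leaves factors undifferentiated.\<close>

lemma Ck_SucD: "Ck (Suc k) f \<Longrightarrow> Ck k f"
proof (induction k arbitrary: f)
  case 0
  then show ?case
    by (simp add: continuous_at_imp_continuous_on differentiable_imp_continuous_within)
next
  case (Suc k)
  then show ?case by simp
qed

lemma Ck_add: "Ck k f \<Longrightarrow> Ck k g \<Longrightarrow> Ck k (\<lambda>x. f x + g x)"
proof (induction k arbitrary: f g)
  case 0
  then show ?case by (simp add: continuous_on_add)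
next
  case (Suc k)
  have "fd (\<lambda>x. f x + g x) x = (\<lambda>v. fd f x v + fd g x v)" for x
    using Suc.prems by (intro fd_eq has_derivative_add has_derivative_fd) auto
  then show ?case
    using Suc by (simp add: differentiable_add)
qed

lemma Ck_linear:
  assumes L: "bounded_linear L" and f: "Ck k f"
  shows "Ck k (\<lambda>x. L (f x))"
  using f
proof (induction k arbitrary: f)
  case 0
  then show ?case
    by (simp add: L bounded_linear.continuous_on)
next
  case (Suc k)
  have "((\<lambda>x. L (f x)) has_derivative (\<lambda>v. L (fd f x v))) (at x)" for x
    using Suc.prems by (intro bounded_linear.has_derivative[OF L] has_derivative_fd) auto
  then have "fd (\<lambda>x. L (f x)) x = (\<lambda>v. L (fd f x v))" "(\<lambda>x. L (f x)) differentiable (at x)" for x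
    by (auto intro: fd_eq simp: differentiable_def)
  then show ?case
    using Suc by simp
qed

lemma Ck_bilinear:
  assumes B: "bounded_bilinear B"
  shows "Ck k f \<Longrightarrow> Ck k g \<Longrightarrow> Ck k (\<lambda>x. B (f x) (g x))"
proof (induction k arbitrary: f g)
  case 0
  then show ?case by (simp add: bounded_bilinear.continuous_on[OF B])
next
  case (Suc k)
  have "((\<lambda>x. B (f x) (g x)) has_derivative (\<lambda>v. B (f x) (fd g x v) + B (fd f x v) (g x))) (at x)" for x
    using Suc.prems by (intro bounded_bilinear.FDERIV[OF B] has_derivative_fd) auto
  then have "fd (\<lambda>x. B (f x) (g x)) x = (\<lambda>v. B (f x) (fd g x v) + B (fd f x v) (g x))"
      "(\<lambda>x. B (f x) (g x)) differentiable (at x)" for x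
    by (auto intro: fd_eq simp: differentiable_def)
  then show ?case
    using Suc Ck_SucD[OF Suc.prems(1)] Ck_SucD[OF Suc.prems(2)] by (auto intro!: Ck_add)
qed

lemma Ck_const: "Ck k (\<lambda>x. c)"
  by (induction k arbitrary: c) auto

lemma Ck_id: "Ck k (\<lambda>x. x)"
proof (cases k)
  case (Suc j)
  have "fd (\<lambda>x. x) x = (\<lambda>v. v)" for x :: 'a
    by (rule fd_eq) (rule has_derivative_ident)
  then show ?thesis by (simp add: Suc Ck_const)
qed simp

lemma smooth_const [simp]: "smooth (\<lambda>x. c)"
  by (simp add: smooth_def Ck_const)

lemma smooth_id [simp]: "smooth (\<lambda>x. x)"
  by (simp add: smooth_def Ck_id)

lemma smooth_add [intro]: "smooth f \<Longrightarrow> smooth g \<Longrightarrow> smooth (\<lambda>x. f x + g x)"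
  by (simp add: smooth_def Ck_add)

lemma smooth_linear: "bounded_linear L \<Longrightarrow> smooth f \<Longrightarrow> smooth (\<lambda>x. L (f x))"
  by (simp add: smooth_def Ck_linear)

lemma smooth_inner [intro]: "smooth f \<Longrightarrow> smooth g \<Longrightarrow> smooth (\<lambda>x. f x \<bullet> g x)"
  by (simp add: smooth_def Ck_bilinear[OF bounded_bilinear_inner])

lemma smooth_scaleR [intro]: "smooth f \<Longrightarrow> smooth g \<Longrightarrow> smooth (\<lambda>x. f x *\<^sub>R g x)"
  by (simp add: smooth_def Ck_bilinear[OF bounded_bilinear_scaleR])

lemma smooth_minus [intro]: "smooth f \<Longrightarrow> smooth g \<Longrightarrow> smooth (\<lambda>x. f x - g x)"
  using smooth_add[of f "\<lambda>x. - g x"] smooth_linear[OF bounded_linear_minus[OF bounded_linear_ident], of g]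
  by simp

lemma smooth_sum [intro]: "(\<And>i. i \<in> S \<Longrightarrow> smooth (f i)) \<Longrightarrow> smooth (\<lambda>x. \<Sum>i\<in>S. f i x)"
  by (induction S rule: infinite_finite_induct) auto

lemma smooth_differentiable: "smooth f \<Longrightarrow> f differentiable (at x)"
  unfolding smooth_def using Ck.simps(2) by blast

lemma smooth_fd: "smooth f \<Longrightarrow> smooth (\<lambda>x. fd f x v)"
  unfolding smooth_def using Ck.simps(2) by blast

lemma smooth_continuous_on: "smooth f \<Longrightarrow> continuous_on S f"
  unfolding smooth_def by (metis Ck.simps(1) continuous_on_subset subset_UNIV)

lemma smooth_has_derivative: "smooth f \<Longrightarrow> (f has_derivative fd f x) (at x within S)"
  by (rule has_derivative_fd) (rule smooth_differentiable)

lemma linear_fd: "smooth f \<Longrightarrow> linear (fd f x)"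
  using has_derivative_linear smooth_has_derivative by blast

lemma fd_add: "smooth f \<Longrightarrow> smooth g \<Longrightarrow> fd (\<lambda>x. f x + g x) x v = fd f x v + fd g x v"
  by (subst fd_eq[OF has_derivative_add[OF smooth_has_derivative smooth_has_derivative]]) auto

lemma fd_scaleR:
  "smooth f \<Longrightarrow> smooth g \<Longrightarrow> fd (\<lambda>x. f x *\<^sub>R g x) x v = f x *\<^sub>R fd g x v + fd f x v *\<^sub>R g x"
  by (subst fd_eq[OF has_derivative_scaleR[OF smooth_has_derivative smooth_has_derivative]]) auto

lemma fd_sum:
  assumes "\<And>i. i \<in> S \<Longrightarrow> smooth (f i)"
  shows "fd (\<lambda>x. \<Sum>i\<in>S. f i x) x v = (\<Sum>i\<in>S. fd (f i) x v)"
  by (subst fd_eq[OF has_derivative_sum[OF smooth_has_derivative]]) (use assms in auto)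

lemma linear_eq_sum_Basis: "linear L \<Longrightarrow> L v = (\<Sum>e\<in>Basis. (v \<bullet> e) *\<^sub>R L e)"
  by (metis (no_types, lifting) euclidean_representation linear_scale linear_sum sum.cong)

text \<open>Here the direction varies with the point, whereas \<open>Ck\<close> speaks of fixed
  directions; expanding \<open>X x\<close> in the ambient basis reduces the claim to those.\<close>

lemma smooth_fd_along:
  assumes "smooth X" "smooth Y"
  shows "smooth (\<lambda>x. fd Y x (X x))"
proof -
  have "(\<lambda>x. fd Y x (X x)) = (\<lambda>x. \<Sum>e\<in>Basis. (X x \<bullet> e) *\<^sub>R fd Y x e)"
    using assms linear_eq_sum_Basis linear_fd by blast
  then show ?thesis
    by (simp only:) (intro smooth_sum smooth_scaleR smooth_inner smooth_fd smooth_const assms)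
qed

lemma linear_fd_fd:
  assumes "smooth Z"
  shows "linear (\<lambda>v. fd (\<lambda>y. fd Z y v) x u)"
proof
  show "fd (\<lambda>y. fd Z y (v + w)) x u = fd (\<lambda>y. fd Z y v) x u + fd (\<lambda>y. fd Z y w) x u" for v w
    using assms by (simp add: linear_add[OF linear_fd] fd_add smooth_fd)
  show "fd (\<lambda>y. fd Z y (r *\<^sub>R v)) x u = r *\<^sub>R fd (\<lambda>y. fd Z y v) x u" for r v
  proof -
    have "fd (\<lambda>y::'a. r) x u = 0" by (simp add: fd_eq[OF has_derivative_const])
    then show ?thesis
      using assms fd_scaleR[OF smooth_const[of r] smooth_fd[OF assms, of v], of x u]
      by (simp add: linear_scale[OF linear_fd])
  qed
qed

text \<open>The first summand freezes the direction at \<open>Y x\<close>, which leaves a pure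
  second derivative of \<open>Z\<close>. Being symmetric by Schwarz's theorem, it will cancel from
  the curvature.\<close>

lemma fd_fd_along:
  assumes Y: "smooth Y" and Z: "smooth Z"
  shows "fd (\<lambda>y. fd Z y (Y y)) x u = fd (\<lambda>y. fd Z y (Y x)) x u + fd Z x (fd Y x u)"
proof -
  have D: "fd (\<lambda>y. Y y \<bullet> e) x u = fd Y x u \<bullet> e" for e
    by (subst fd_eq[OF has_derivative_inner_left[OF smooth_has_derivative[OF Y]]]) simp
  have "(\<lambda>x. fd Z x (Y x)) = (\<lambda>x. \<Sum>e\<in>Basis. (Y x \<bullet> e) *\<^sub>R fd Z x e)"
    using assms linear_eq_sum_Basis linear_fd by blast
  then have "fd (\<lambda>y. fd Z y (Y y)) x u = (\<Sum>e\<in>Basis. fd (\<lambda>x. (Y x \<bullet> e) *\<^sub>R fd Z x e) x u)"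
    using assms by (simp add: fd_sum smooth_scaleR smooth_inner smooth_fd)
  also have "\<dots> = (\<Sum>e\<in>Basis. (Y x \<bullet> e) *\<^sub>R fd (\<lambda>y. fd Z y e) x u + (fd Y x u \<bullet> e) *\<^sub>R fd Z x e)"
    using assms by (simp add: fd_scaleR smooth_inner smooth_fd D)
  finally show ?thesis
    using linear_eq_sum_Basis[OF linear_fd_fd[OF Z], of "Y x" x u]
      linear_eq_sum_Basis[OF linear_fd[OF Z], of x "fd Y x u"] by (simp only: sum.distrib)
qed

text \<open>Schwarz's theorem: the second difference quotient of \<open>f\<close> is, by the mean value theorem, both a
  value of \<open>D\<^sub>v D\<^sub>u f\<close> and a value of \<open>D\<^sub>u D\<^sub>v f\<close> near the base point.\<close>

lemma second_difference:
  fixes f :: "'a::euclidean_space \<Rightarrow> real"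
  assumes f: "smooth f" and t: "t > 0"
  obtains a b where "0 < a" "a < t" "0 < b" "b < t"
    "f (x + t *\<^sub>R u + t *\<^sub>R v) - f (x + t *\<^sub>R u) - f (x + t *\<^sub>R v) + f x
       = t * (t * fd (\<lambda>y. fd f y u) (x + a *\<^sub>R u + b *\<^sub>R v) v)"
proof -
  have chain: "((\<lambda>s. g (z + s *\<^sub>R w)) has_real_derivative fd g (z + s *\<^sub>R w) w) (at s)"
    if "smooth g" for g :: "'a \<Rightarrow> real" and z w s
  proof -
    have "((\<lambda>s. z + s *\<^sub>R w) has_derivative (\<lambda>r. r *\<^sub>R w)) (at s)"
      by (auto intro!: derivative_eq_intros)
    then have "((\<lambda>s. g (z + s *\<^sub>R w)) has_derivative (\<lambda>r. fd g (z + s *\<^sub>R w) (r *\<^sub>R w))) (at s)"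
      using has_derivative_compose smooth_has_derivative[OF that] by blast
    moreover have "(\<lambda>r. fd g (z + s *\<^sub>R w) (r *\<^sub>R w)) = (*) (fd g (z + s *\<^sub>R w) w)"
      using that by (auto simp: linear_scale[OF linear_fd])
    ultimately show ?thesis
      by (simp add: has_field_derivative_def)
  qed
  let ?\<phi> = "\<lambda>s. f ((x + t *\<^sub>R v) + s *\<^sub>R u) - f (x + s *\<^sub>R u)"
  have "(?\<phi> has_real_derivative fd f ((x + t *\<^sub>R v) + s *\<^sub>R u) u - fd f (x + s *\<^sub>R u) u) (at s)" for s
    by (intro DERIV_diff chain f)
  from MVT2[OF t, where f = ?\<phi>, OF this] obtain a where a: "0 < a" "a < t"
    "?\<phi> t - ?\<phi> 0 = (t - 0) * (fd f ((x + t *\<^sub>R v) + a *\<^sub>R u) u - fd f (x + a *\<^sub>R u) u)"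
    by blast
  let ?\<psi> = "\<lambda>s. fd f ((x + a *\<^sub>R u) + s *\<^sub>R v) u"
  from MVT2[OF t, where f = ?\<psi>, OF chain[OF smooth_fd[OF f]]] obtain b where b: "0 < b" "b < t"
    "?\<psi> t - ?\<psi> 0 = (t - 0) * fd (\<lambda>y. fd f y u) ((x + a *\<^sub>R u) + b *\<^sub>R v) v"
    by blast
  show thesis
    using a b by (intro that[of a b]) (simp_all add: algebra_simps)
qed

lemma fd_fd_symmetric_real:
  fixes f :: "'a::euclidean_space \<Rightarrow> real"
  assumes f: "smooth f"
  shows "fd (\<lambda>y. fd f y u) x v = fd (\<lambda>y. fd f y v) x u"
proof (rule ccontr)
  let ?F = "\<lambda>y. fd (\<lambda>y. fd f y u) y v" and ?G = "\<lambda>y. fd (\<lambda>y. fd f y v) y u"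
  let ?e = "\<bar>?F x - ?G x\<bar> / 2"
  assume "?F x \<noteq> ?G x"
  then have e: "?e > 0" by simp
  have "continuous_on UNIV ?F" "continuous_on UNIV ?G"
    using f by (auto intro!: smooth_continuous_on smooth_fd)
  then obtain d1 d2 where d: "d1 > 0" "\<And>y. dist y x < d1 \<Longrightarrow> dist (?F y) (?F x) < ?e"
      "d2 > 0" "\<And>y. dist y x < d2 \<Longrightarrow> dist (?G y) (?G x) < ?e"
    using e unfolding continuous_on_iff by (metis UNIV_I)
  \<comment> \<open>The intermediate points lie within \<open>t * (norm u + norm v)\<close> of
    \<open>x\<close>. The extra 1 makes \<open>N\<close> positive and keeps this bound strictly
    below \<open>t * N = min d1 d2\<close>.\<close>
  define N where "N = norm u + norm v + 1"
  define t where "t = min d1 d2 / N"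
  have N: "N > 0"
    unfolding N_def by (smt (verit) norm_ge_zero)
  then have t: "t > 0"
    using d by (simp add: t_def)
  have near: "dist (x + a *\<^sub>R w + b *\<^sub>R z) x < min d1 d2"
    if "0 < a" "a < t" "0 < b" "b < t" "norm w + norm z < N" for a b and w z :: 'a
  proof -
    have "norm (a *\<^sub>R w + b *\<^sub>R z) \<le> a * norm w + b * norm z"
      using that norm_triangle_ineq[of "a *\<^sub>R w" "b *\<^sub>R z"] by simp
    also have "\<dots> \<le> t * norm w + t * norm z"
      using that by (intro add_mono mult_right_mono) auto
    also have "\<dots> = t * (norm w + norm z)" by (simp add: algebra_simps)
    also have "\<dots> < t * N" using that t by simp
    also have "\<dots> = min d1 d2" using N by (simp add: t_def)
    finally show ?thesis by (simp add: dist_norm algebra_simps)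
  qed
  obtain a b where ab: "0 < a" "a < t" "0 < b" "b < t"
    "f (x + t *\<^sub>R u + t *\<^sub>R v) - f (x + t *\<^sub>R u) - f (x + t *\<^sub>R v) + f x
       = t * (t * ?F (x + a *\<^sub>R u + b *\<^sub>R v))"
    using second_difference[OF f t] by blast
  obtain a' b' where ab': "0 < a'" "a' < t" "0 < b'" "b' < t"
    "f (x + t *\<^sub>R v + t *\<^sub>R u) - f (x + t *\<^sub>R v) - f (x + t *\<^sub>R u) + f x
       = t * (t * ?G (x + a' *\<^sub>R v + b' *\<^sub>R u))"
    using second_difference[OF f t] by blast
  have "t * (t * ?F (x + a *\<^sub>R u + b *\<^sub>R v)) = t * (t * ?G (x + a' *\<^sub>R v + b' *\<^sub>R u))"
    unfolding ab(5)[symmetric] ab'(5)[symmetric] by (simp add: algebra_simps)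
  then have "?F (x + a *\<^sub>R u + b *\<^sub>R v) = ?G (x + a' *\<^sub>R v + b' *\<^sub>R u)"
    using t by simp
  moreover have "dist (?F (x + a *\<^sub>R u + b *\<^sub>R v)) (?F x) < ?e"
    using near[of a b u v] ab by (intro d) (simp add: N_def)
  moreover have "dist (?G (x + a' *\<^sub>R v + b' *\<^sub>R u)) (?G x) < ?e"
    using near[of a' b' v u] ab' by (intro d) (simp add: N_def)
  ultimately show False
    by (simp add: dist_real_def abs_if split: if_splits)
qed

lemma fd_fd_symmetric:
  assumes Z: "smooth Z"
  shows "fd (\<lambda>y. fd Z y u) x v = fd (\<lambda>y. fd Z y v) x u"
proof (rule euclidean_eqI)
  fix e :: 'b assume "e \<in> Basis"
  have D: "fd (\<lambda>y. W y \<bullet> e) y w = fd W y w \<bullet> e" if "smooth W" for W :: "'a \<Rightarrow> 'b" and y w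
    by (subst fd_eq[OF has_derivative_inner_left[OF smooth_has_derivative[OF that]]]) simp
  have "smooth (\<lambda>y. Z y \<bullet> e)" using Z by auto
  from fd_fd_symmetric_real[OF this, of u x v]
  show "fd (\<lambda>y. fd Z y u) x v \<bullet> e = fd (\<lambda>y. fd Z y v) x u \<bullet> e"
    by (simp add: D Z smooth_fd)
qed

section \<open>Derivatives along a submanifold\<close>

text \<open>Composing \<open>f\<close> with a curve in \<open>M\<close> of velocity \<open>v\<close>
  gives a function of one real variable, whose derivative at 0 is unique and equals both
  values.\<close>

lemma derivative_within_tangent_unique:
  fixes f :: "'a::euclidean_space \<Rightarrow> 'b::real_normed_vector"
  assumes L: "(f has_derivative L) (at x within M)" and L': "(f has_derivative L') (at x within M)"
    and v: "v \<in> tangent_space M x"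
  shows "L v = L' v"
proof -
  from v have "\<exists>\<gamma>. (\<forall>t. \<gamma> t \<in> M) \<and> \<gamma> 0 = x \<and> (\<gamma> has_derivative (\<lambda>r. r *\<^sub>R v)) (at (0::real))"
    by (simp add: tangent_space_def has_vector_derivative_def)
  then obtain \<gamma> :: "real \<Rightarrow> 'a"
    where "(\<forall>t. \<gamma> t \<in> M) \<and> \<gamma> 0 = x \<and> (\<gamma> has_derivative (\<lambda>r. r *\<^sub>R v)) (at 0)" ..
  then have \<gamma>: "\<forall>t. \<gamma> t \<in> M" "\<gamma> 0 = x" "(\<gamma> has_derivative (\<lambda>r. r *\<^sub>R v)) (at 0)"
    by simp_all
  have *: "((\<lambda>t. f (\<gamma> t)) has_derivative (\<lambda>r. K (r *\<^sub>R v))) (at 0)"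
    if "(f has_derivative K) (at x within M)" for K
  proof -
    have "(f has_derivative K) (at (\<gamma> 0) within \<gamma> ` UNIV)"
      unfolding \<gamma>(2) by (rule has_derivative_subset[OF that]) (use \<gamma>(1) in auto)
    from has_derivative_in_compose[OF \<gamma>(3) this] show ?thesis .
  qed
  have "(\<lambda>r. L (r *\<^sub>R v)) = (\<lambda>r. L' (r *\<^sub>R v))"
    by (rule has_derivative_unique[OF *[OF L] *[OF L']])
  from fun_cong[OF this, of 1] show ?thesis by simp
qed

text \<open>Both \<open>fd X x\<close> and \<open>fd Y x\<close> are derivatives of \<open>X\<close>
  within \<open>M\<close>, so uniqueness along tangent vectors applies.\<close>

lemma fd_cong_on:
  assumes "smooth X" "smooth Y" "\<And>y. y \<in> M \<Longrightarrow> X y = Y y" "x \<in> M" "v \<in> tangent_space M x"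
  shows "fd X x v = fd Y x v"
  using assms
  by (intro derivative_within_tangent_unique[where M = M and f = X])
    (auto intro: smooth_has_derivative has_derivative_transform[OF _ _ smooth_has_derivative])

section \<open>Products of odd-dimensional spheres\<close>

text \<open>The maps \<open>p i\<close> are the orthogonal projections of the ambient space onto complex subspaces, and
  \<open>M\<close> is the product of their unit spheres.  With the contact forms \<open>\<eta> i x\<close>, dual to the Hopf vector
  fields \<open>J (p i x)\<close>, the metric is the round one plus \<open>\<Sum>k\<^sub>i\<^sub>j \<eta>\<^sub>i \<eta>\<^sub>j\<close>, and
  \<open>\<Gamma>\<close> is the difference between its Levi-Civita connection and the flat one.\<close>

locale odd_spheres =
  fixes J :: "'a::euclidean_space \<Rightarrow> 'a" and p :: "'i::finite \<Rightarrow> 'a \<Rightarrow> 'a" and k :: "'i \<Rightarrow> 'i \<Rightarrow> real"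
  assumes linear_J: "linear J" and J_J [simp]: "J (J v) = - v"
    and inner_J_J: "J v \<bullet> J w = v \<bullet> w"
    and linear_p: "linear (p i)" and p_inner [simp]: "p i v \<bullet> w = v \<bullet> p i w"
    and p_p [simp]: "p i (p j v) = (if i = j then p i v else 0)"
    and sum_p: "(\<Sum>i\<in>UNIV. p i v) = v" and p_J [simp]: "p i (J v) = J (p i v)"
    and k_sym: "k i j = k j i"
    and k_nondegenerate: "(\<And>j. s j + (\<Sum>i\<in>UNIV. s i * k i j) = 0) \<Longrightarrow> s i = 0"
begin

definition M :: "'a set" where
  "M = {x. \<forall>i. x \<bullet> p i x = 1}"

definition T :: "'a \<Rightarrow> 'a set" where
  "T x = {v. \<forall>i. v \<bullet> p i x = 0}"

definition \<eta> :: "'i \<Rightarrow> 'a \<Rightarrow> 'a \<Rightarrow> real" where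
  "\<eta> i x v = v \<bullet> J (p i x)"

definition \<theta> :: "'i \<Rightarrow> 'a \<Rightarrow> 'a \<Rightarrow> real" where
  "\<theta> i x v = (\<Sum>j\<in>UNIV. k i j * \<eta> j x v)"

text \<open>For \<open>x\<close> in \<open>M\<close> this is the tangential part of
  \<open>J (p i v)\<close>; for tangent \<open>v\<close> it is \<open>J\<close> applied to the
  horizontal part of \<open>p i v\<close>.\<close>

definition B :: "'i \<Rightarrow> 'a \<Rightarrow> 'a \<Rightarrow> 'a" where
  "B i x v = J (p i v) + \<eta> i x v *\<^sub>R p i x"

definition G :: "'a \<Rightarrow> 'a \<Rightarrow> 'a \<Rightarrow> real" where
  "G x v w = v \<bullet> w + (\<Sum>i\<in>UNIV. \<eta> i x v * \<theta> i x w)"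

text \<open>The first summand is the correction by the second fundamental form of the spheres; the
  other two are the change of the round connection caused by the terms with
  \<open>k\<close>.\<close>

definition \<Gamma> :: "'a \<Rightarrow> 'a \<Rightarrow> 'a \<Rightarrow> 'a" where
  "\<Gamma> x v w = (\<Sum>i\<in>UNIV. (v \<bullet> p i w) *\<^sub>R p i x + \<theta> i x w *\<^sub>R B i x v + \<theta> i x v *\<^sub>R B i x w)"

definition conn :: "('a \<Rightarrow> 'a) \<Rightarrow> ('a \<Rightarrow> 'a) \<Rightarrow> 'a \<Rightarrow> 'a" where
  "conn X Y x = fd Y x (X x) + \<Gamma> x (X x) (Y x)"

lemmas J_simps [simp] = linear_add[OF linear_J] linear_diff[OF linear_J] linear_neg[OF linear_J]
  linear_scale[OF linear_J] linear_0[OF linear_J] linear_sum[OF linear_J]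

lemmas p_simps [simp] = linear_add[OF linear_p] linear_diff[OF linear_p] linear_neg[OF linear_p]
  linear_scale[OF linear_p] linear_0[OF linear_p] linear_sum[OF linear_p]

lemma inner_J [simp]: "J v \<bullet> w = - (v \<bullet> J w)"
  using inner_J_J[of v "J w"] by simp

lemma inner_p_commute: "v \<bullet> p i w = w \<bullet> p i v"
  by (metis inner_commute p_inner)

lemma inner_Jp_commute: "v \<bullet> J (p i w) = - (w \<bullet> J (p i v))"
  by (metis inner_J inner_commute p_J p_inner)

lemma inner_J_self [simp]: "v \<bullet> J (p i v) = 0"
  using inner_Jp_commute[of v i v] by simp

lemmas bounded_linear_p = linear_conv_bounded_linear[THEN iffD1, OF linear_p]
lemmas bounded_linear_J = linear_conv_bounded_linear[THEN iffD1, OF linear_J]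

lemma \<eta>_linear [simp]:
  "\<eta> i x (v + w) = \<eta> i x v + \<eta> i x w" "\<eta> i x (v - w) = \<eta> i x v - \<eta> i x w"
  "\<eta> i x (- v) = - \<eta> i x v" "\<eta> i x (r *\<^sub>R v) = r * \<eta> i x v" "\<eta> i x 0 = 0"
  "\<eta> i x (\<Sum>j\<in>S. f j) = (\<Sum>j\<in>S. \<eta> i x (f j))"
  by (simp_all add: \<eta>_def inner_left_distrib inner_diff_left inner_sum_left)

lemma \<theta>_linear [simp]:
  "\<theta> i x (v + w) = \<theta> i x v + \<theta> i x w" "\<theta> i x (v - w) = \<theta> i x v - \<theta> i x w"
  "\<theta> i x (- v) = - \<theta> i x v" "\<theta> i x (r *\<^sub>R v) = r * \<theta> i x v" "\<theta> i x 0 = 0"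
  by (simp_all add: \<theta>_def algebra_simps sum.distrib sum_subtractf sum_negf sum_distrib_left)

lemma \<theta>_sum [simp]: "\<theta> i x (\<Sum>j\<in>S. f j) = (\<Sum>j\<in>S. \<theta> i x (f j))"
  by (induction S rule: infinite_finite_induct) auto

lemma B_linear [simp]:
  "B i x (v + w) = B i x v + B i x w" "B i x (v - w) = B i x v - B i x w"
  "B i x (- v) = - B i x v" "B i x (r *\<^sub>R v) = r *\<^sub>R B i x v" "B i x 0 = 0"
  by (simp_all add: B_def algebra_simps)

lemma \<Gamma>_commute: "\<Gamma> x v w = \<Gamma> x w v"
  by (simp add: \<Gamma>_def inner_p_commute[of v] add.commute add.left_commute)

lemma \<Gamma>_add: "\<Gamma> x (v + v') w = \<Gamma> x v w + \<Gamma> x v' w" "\<Gamma> x w (v + v') = \<Gamma> x w v + \<Gamma> x w v'"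
  by (simp_all add: \<Gamma>_def algebra_simps inner_left_distrib inner_right_distrib sum.distrib)

lemma \<Gamma>_scale: "\<Gamma> x (r *\<^sub>R v) w = r *\<^sub>R \<Gamma> x v w" "\<Gamma> x w (r *\<^sub>R v) = r *\<^sub>R \<Gamma> x w v"
  by (simp_all add: \<Gamma>_def algebra_simps scaleR_sum_right)

lemma \<Gamma>_diff: "\<Gamma> x (v - v') w = \<Gamma> x v w - \<Gamma> x v' w" "\<Gamma> x w (v - v') = \<Gamma> x w v - \<Gamma> x w v'"
  using \<Gamma>_add(1)[of x "v - v'" v' w] \<Gamma>_add(2)[of x w "v - v'" v'] by (simp_all add: algebra_simps)

lemma M_D: "x \<in> M \<Longrightarrow> x \<bullet> p i x = 1"
  by (simp add: M_def)

lemma T_D: "v \<in> T x \<Longrightarrow> v \<bullet> p i x = 0" "v \<in> T x \<Longrightarrow> x \<bullet> p i v = 0"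
  by (simp_all add: T_def inner_p_commute[of x])

lemma \<eta>_p [simp]: "\<eta> i x (p j x) = 0"
  by (simp add: \<eta>_def)

lemma \<theta>_p [simp]: "\<theta> i x (p j x) = 0"
  by (simp add: \<theta>_def)

lemma \<eta>_Jp:
  assumes "x \<in> M" shows "\<eta> i x (J (p j x)) = (if i = j then 1 else 0)"
  using M_D[OF assms] by (simp add: \<eta>_def)

lemma \<theta>_Jp:
  assumes "x \<in> M" shows "\<theta> i x (J (p j x)) = k i j"
  by (simp add: \<theta>_def \<eta>_Jp[OF assms] if_distrib cong: if_cong)

lemma \<eta>_p': "\<eta> i x (p j v) = (if i = j then \<eta> i x v else 0)"
  by (simp add: \<eta>_def)

lemma \<eta>_Jp_v:
  assumes "v \<in> T x" shows "\<eta> i x (J (p j v)) = 0"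
  using T_D[OF assms] by (simp add: \<eta>_def)

lemma \<eta>_B:
  assumes "v \<in> T x" shows "\<eta> j x (B i x v) = 0"
  by (simp add: B_def \<eta>_Jp_v[OF assms])

lemma B_inner_p:
  assumes "x \<in> M" shows "B i x v \<bullet> p j x = 0"
  using M_D[OF assms] by (simp add: B_def \<eta>_def inner_left_distrib)

lemma B_inner:
  assumes "z \<in> T x" shows "B i x v \<bullet> z = z \<bullet> J (p i v)"
  using T_D[OF assms] by (simp add: B_def inner_left_distrib inner_Jp_commute[of v])

lemma Jp_T: "x \<in> M \<Longrightarrow> J (p i x) \<in> T x"
  by (simp add: T_def)

text \<open>Only the second fundamental form is normal to \<open>M\<close>. This value cancels the
  normal part of a flat derivative of a tangent field.\<close>

lemma \<Gamma>_inner_p: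
  assumes "x \<in> M" shows "\<Gamma> x v w \<bullet> p j x = v \<bullet> p j w"
  using M_D[OF assms]
  by (simp add: \<Gamma>_def inner_sum_left inner_left_distrib B_inner_p[OF assms] if_distrib[of "inner _"]
      if_distrib[of "(*) _"] cong: if_cong)

text \<open>For tangent arguments the tangential part of \<open>\<Gamma>\<close> is horizontal, so
  its pairings under \<open>G\<close> reduce to Euclidean ones.\<close>

lemma \<eta>_\<Gamma>:
  assumes "v \<in> T x" "w \<in> T x" shows "\<eta> i x (\<Gamma> x v w) = 0"
  by (simp add: \<Gamma>_def \<eta>_B assms)

lemma \<theta>_\<Gamma>:
  assumes "v \<in> T x" "w \<in> T x" shows "\<theta> i x (\<Gamma> x v w) = 0"
  by (simp add: \<theta>_def \<eta>_\<Gamma>[OF assms])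

lemma \<Gamma>_inner:
  assumes "z \<in> T x"
  shows "\<Gamma> x v w \<bullet> z = (\<Sum>i\<in>UNIV. \<theta> i x w * (z \<bullet> J (p i v)) + \<theta> i x v * (z \<bullet> J (p i w)))"
  using T_D[OF assms] by (simp add: \<Gamma>_def inner_sum_left inner_left_distrib B_inner[OF assms])

lemma \<eta>_\<theta>_commute: "(\<Sum>i\<in>UNIV. \<eta> i x v * \<theta> i y w) = (\<Sum>i\<in>UNIV. \<theta> i x v * \<eta> i y w)"
proof -
  have "(\<Sum>i\<in>UNIV. \<eta> i x v * \<theta> i y w) = (\<Sum>i\<in>UNIV. \<Sum>j\<in>UNIV. k i j * \<eta> i x v * \<eta> j y w)"
    by (simp add: \<theta>_def sum_distrib_left mult_ac)
  also have "\<dots> = (\<Sum>j\<in>UNIV. \<Sum>i\<in>UNIV. k j i * \<eta> i x v * \<eta> j y w)"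
    by (subst sum.swap) (simp add: k_sym)
  finally show ?thesis
    by (simp add: \<theta>_def sum_distrib_right)
qed

lemma G_add: "G x (v + v') w = G x v w + G x v' w" "G x w (v + v') = G x w v + G x w v'"
  by (simp_all add: G_def algebra_simps inner_left_distrib inner_right_distrib sum.distrib)

lemma G_diff: "G x (v - v') w = G x v w - G x v' w" "G x w (v - v') = G x w v - G x w v'"
  using G_add(1)[of x "v - v'" v' w] G_add(2)[of x w "v - v'" v'] by (simp_all add: algebra_simps)

lemma G_commute: "G x v w = G x w v"
  using \<eta>_\<theta>_commute[of x v x w] by (simp add: G_def inner_commute mult.commute)

text \<open>On the Hopf vectors \<open>J (p j x)\<close> the form \<open>G\<close> has the matrix
  identity plus \<open>k\<close>. Testing against them gives \<open>\<eta> i x v = 0\<close> by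
  \<open>k_nondegenerate\<close>, and then \<open>G x v v\<close> is the Euclidean square of
  \<open>v\<close>.\<close>

lemma G_nondegenerate:
  assumes x: "x \<in> M" and v: "v \<in> T x" and 0: "\<And>z. z \<in> T x \<Longrightarrow> G x v z = 0"
  shows "v = 0"
proof -
  have \<eta>: "\<eta> i x v = 0" for i
  proof (rule k_nondegenerate)
    fix j
    have "G x v (J (p j x)) = 0"
      using 0 Jp_T[OF x] by blast
    then show "\<eta> j x v + (\<Sum>i\<in>UNIV. \<eta> i x v * k i j) = 0"
      by (simp add: G_def \<theta>_Jp[OF x]) (simp add: \<eta>_def)
  qed
  from 0[OF v] show ?thesis
    by (simp add: G_def \<eta>)
qed

text \<open>This is metric compatibility at a point: the right-hand side is the derivative of
  \<open>G\<close> in its base point in the direction \<open>u\<close>, as \<open>\<eta>\<close> and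
  \<open>\<theta>\<close> are linear in the base point.\<close>

lemma G_\<Gamma>_skew:
  assumes "u \<in> T x" "v \<in> T x" "w \<in> T x"
  shows "G x (\<Gamma> x u v) w + G x v (\<Gamma> x u w)
    = (\<Sum>i\<in>UNIV. \<eta> i u v * \<theta> i x w + \<eta> i x v * \<theta> i u w)"
proof -
  have "G x (\<Gamma> x u v) w + G x (\<Gamma> x u w) v
    = (\<Sum>i\<in>UNIV. \<theta> i x v * \<eta> i u w + \<theta> i x w * \<eta> i u v)"
    by (simp add: G_def \<eta>_\<Gamma> assms \<Gamma>_inner sum.distrib[symmetric])
      (simp add: \<eta>_def inner_Jp_commute[of v _ w])
  then show ?thesis
    using \<eta>_\<theta>_commute[of x v u w] by (simp add: G_commute[of x v] sum.distrib mult.commute)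
qed

section \<open>Tangent spaces and vector fields of the product of spheres\<close>

lemma tangent_space_M:
  assumes x: "x \<in> M"
  shows "tangent_space M x = T x"
proof (intro equalityI subsetI)
  fix v assume v: "v \<in> tangent_space M x"
  show "v \<in> T x"
    unfolding T_def
  proof safe
    fix i
    have "((\<lambda>y. y \<bullet> p i y) has_derivative (\<lambda>u. x \<bullet> p i u + u \<bullet> p i x)) (at x within M)"
      by (intro has_derivative_inner has_derivative_ident bounded_linear.has_derivative[OF bounded_linear_p])
    moreover have "((\<lambda>y. y \<bullet> p i y) has_derivative (\<lambda>u. 0)) (at x within M)"
      by (rule has_derivative_transform[OF x _ has_derivative_const[of 1]]) (simp add: M_D)
    ultimately have "x \<bullet> p i v + v \<bullet> p i x = 0"
      using v by (rule derivative_within_tangent_unique)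
    then show "v \<bullet> p i x = 0"
      by (simp add: inner_p_commute[of x])
  qed
next
  fix v assume v: "v \<in> T x"
  \<comment> \<open>The curve moves from \<open>x\<close> along \<open>v\<close> and is renormalized
    in each component. As \<open>p i x\<close> and \<open>p i v\<close> are orthogonal, the squared
    norm of \<open>p i x + t *\<^sub>R p i v\<close> is the radicand; it is even in
    \<open>t\<close>, so \<open>r i\<close> has derivative 0 at 0.\<close>
  define r where "r i t = 1 / sqrt (1 + t\<^sup>2 * (v \<bullet> p i v))" for i t
  define \<gamma> where "\<gamma> t = (\<Sum>i\<in>UNIV. r i t *\<^sub>R (p i x + t *\<^sub>R p i v))" for t
  have pos: "v \<bullet> p i v \<ge> 0" for i
    by (metis inner_ge_zero p_inner p_p)
  have p\<gamma>: "p i (\<gamma> t) = r i t *\<^sub>R (p i x + t *\<^sub>R p i v)" for i t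
    by (simp add: \<gamma>_def scaleR_right_distrib if_distrib cong: if_cong)
  have "\<gamma> t \<in> M" for t
    unfolding M_def
  proof safe
    fix i
    have "\<gamma> t \<bullet> p i (\<gamma> t) = p i (\<gamma> t) \<bullet> p i (\<gamma> t)" by simp
    also have "\<dots> = (r i t)\<^sup>2 * (1 + t\<^sup>2 * (v \<bullet> p i v))"
      unfolding p\<gamma> using T_D[OF v] M_D[OF x]
      by (simp add: inner_left_distrib inner_right_distrib power2_eq_square algebra_simps)
    also have "1 + t\<^sup>2 * (v \<bullet> p i v) > 0"
      using pos[of i] by (smt (verit) mult_nonneg_nonneg zero_le_power2)
    then have "(r i t)\<^sup>2 * (1 + t\<^sup>2 * (v \<bullet> p i v)) = 1"
      by (simp add: r_def power_divide)
    finally show "\<gamma> t \<bullet> p i (\<gamma> t) = 1" .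
  qed
  moreover have "\<gamma> 0 = x"
    by (simp add: \<gamma>_def r_def sum_p)
  moreover have "(\<gamma> has_vector_derivative v) (at 0)"
  proof -
    have r: "(r i has_real_derivative 0) (at 0)" for i
      unfolding r_def by (auto intro!: derivative_eq_intros)
    have "((\<lambda>t. p i x + t *\<^sub>R p i v) has_vector_derivative p i v) (at 0)" for i
      by (auto intro!: derivative_eq_intros)
    from has_vector_derivative_scaleR[OF r this]
    have "(\<gamma> has_vector_derivative (\<Sum>i\<in>UNIV. p i v)) (at 0)"
      unfolding \<gamma>_def by (intro has_vector_derivative_sum) (simp add: r_def)
    then show ?thesis by (simp add: sum_p)
  qed
  ultimately show "v \<in> tangent_space M x"
    unfolding tangent_space_def by blast
qed

lemma smooth_p: "smooth f \<Longrightarrow> smooth (\<lambda>x. p i (f x))"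
  by (rule smooth_linear[OF bounded_linear_p])

lemma smooth_J: "smooth f \<Longrightarrow> smooth (\<lambda>x. J (f x))"
  by (rule smooth_linear[OF bounded_linear_J])

lemma smooth_mult: "smooth f \<Longrightarrow> smooth g \<Longrightarrow> smooth (\<lambda>x. f x * g x :: real)"
  using smooth_inner[of f g] by (simp add: inner_real_def)

lemma smooth_\<eta>: "smooth f \<Longrightarrow> smooth g \<Longrightarrow> smooth (\<lambda>x. \<eta> i (f x) (g x))"
  unfolding \<eta>_def by (intro smooth_inner smooth_J smooth_p)

lemma smooth_\<theta>: "smooth f \<Longrightarrow> smooth g \<Longrightarrow> smooth (\<lambda>x. \<theta> i (f x) (g x))"
  unfolding \<theta>_def by (intro smooth_sum smooth_mult smooth_const smooth_\<eta>)

lemma smooth_B: "smooth f \<Longrightarrow> smooth g \<Longrightarrow> smooth (\<lambda>x. B i (f x) (g x))"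
  unfolding B_def by (intro smooth_add smooth_scaleR smooth_J smooth_p smooth_\<eta>)

lemma smooth_\<Gamma>: "smooth f \<Longrightarrow> smooth g \<Longrightarrow> smooth h \<Longrightarrow> smooth (\<lambda>x. \<Gamma> (f x) (g x) (h x))"
  unfolding \<Gamma>_def by (intro smooth_sum smooth_add smooth_scaleR smooth_inner smooth_p smooth_\<theta> smooth_B)

lemma smooth_conn: "smooth X \<Longrightarrow> smooth Y \<Longrightarrow> smooth (conn X Y)"
  unfolding conn_def[abs_def] by (intro smooth_add smooth_fd_along smooth_\<Gamma> smooth_id)

lemma vector_fields_iff: "X \<in> vector_fields M \<longleftrightarrow> smooth X \<and> (\<forall>x\<in>M. X x \<in> T x)"
  by (simp add: vector_fields_def tangent_space_M)

text \<open>The tangential projection of the constant field \<open>v\<close> is polynomial, hence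
  smooth on the whole ambient space, while tangency is needed on \<open>M\<close> only.\<close>

lemma field_exists:
  assumes "x \<in> M" "v \<in> T x"
  shows "\<exists>X\<in>vector_fields M. X x = v"
proof
  define X where "X y = v - (\<Sum>i\<in>UNIV. (v \<bullet> p i y) *\<^sub>R p i y)" for y
  show "X x = v"
    using T_D[OF assms(2)] by (simp add: X_def)
  have "smooth X"
    unfolding X_def by (intro smooth_minus smooth_const smooth_sum smooth_scaleR smooth_inner smooth_p smooth_id)
  moreover have "X y \<in> T y" if "y \<in> M" for y
    using M_D[OF that] by (simp add: T_def X_def inner_diff_left inner_sum_left if_distrib cong: if_cong)
  ultimately show "X \<in> vector_fields M"
    by (simp add: vector_fields_iff)
qed

end

section \<open>The Levi-Civita connection and its curvature\<close>

lemma affine_connection_vector_field: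
  "affine_connection M D \<Longrightarrow> X \<in> vector_fields M \<Longrightarrow> Y \<in> vector_fields M \<Longrightarrow> D X Y \<in> vector_fields M"
  by (simp add: affine_connection_def)

context odd_spheres
begin

text \<open>The derivative of \<open>\<Gamma> x v w\<close> in the base point \<open>x\<close>, in
  the direction \<open>u\<close>.\<close>

definition \<Gamma>' :: "'a \<Rightarrow> 'a \<Rightarrow> 'a \<Rightarrow> 'a \<Rightarrow> 'a" where
  "\<Gamma>' x u v w = (\<Sum>i\<in>UNIV. (v \<bullet> p i w) *\<^sub>R p i u
     + (\<theta> i u w *\<^sub>R B i x v + \<theta> i x w *\<^sub>R (\<eta> i u v *\<^sub>R p i x + \<eta> i x v *\<^sub>R p i u))
     + (\<theta> i u v *\<^sub>R B i x w + \<theta> i x v *\<^sub>R (\<eta> i u w *\<^sub>R p i x + \<eta> i x w *\<^sub>R p i u)))"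

text \<open>The coordinate formula for the curvature, with \<open>\<Gamma>\<close> in the role of
  the Christoffel symbols.\<close>

definition riemann :: "'a \<Rightarrow> 'a \<Rightarrow> 'a \<Rightarrow> 'a \<Rightarrow> 'a" where
  "riemann x u v w = \<Gamma>' x u v w - \<Gamma>' x v u w + \<Gamma> x u (\<Gamma> x v w) - \<Gamma> x v (\<Gamma> x u w)"

lemma has_derivative_p:
  "(f has_derivative f') F \<Longrightarrow> ((\<lambda>y. p i (f y)) has_derivative (\<lambda>u. p i (f' u))) F"
  by (rule bounded_linear.has_derivative[OF bounded_linear_p])

lemma has_derivative_J:
  "(f has_derivative f') F \<Longrightarrow> ((\<lambda>y. J (f y)) has_derivative (\<lambda>u. J (f' u))) F"
  by (rule bounded_linear.has_derivative[OF bounded_linear_J])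

lemma has_derivative_\<eta>:
  assumes "(Y has_derivative Y') (at x within S)"
  shows "((\<lambda>y. \<eta> i y (Y y)) has_derivative (\<lambda>u. \<eta> i u (Y x) + \<eta> i x (Y' u))) (at x within S)"
  unfolding \<eta>_def
  by (rule has_derivative_inner[OF assms has_derivative_J[OF has_derivative_p[OF has_derivative_ident]]])

lemma has_derivative_\<theta>:
  assumes "(Y has_derivative Y') (at x within S)"
  shows "((\<lambda>y. \<theta> i y (Y y)) has_derivative (\<lambda>u. \<theta> i u (Y x) + \<theta> i x (Y' u))) (at x within S)"
proof -
  have "((\<lambda>y. \<Sum>j\<in>UNIV. k i j * \<eta> j y (Y y)) has_derivative
      (\<lambda>u. \<Sum>j\<in>UNIV. k i j * (\<eta> j u (Y x) + \<eta> j x (Y' u)))) (at x within S)"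
    by (intro has_derivative_sum has_derivative_mult_right has_derivative_\<eta> assms)
  then show ?thesis
    by (simp add: \<theta>_def distrib_left sum.distrib)
qed

lemma has_derivative_B:
  assumes "(Y has_derivative Y') (at x within S)"
  shows "((\<lambda>y. B i y (Y y)) has_derivative
    (\<lambda>u. \<eta> i u (Y x) *\<^sub>R p i x + \<eta> i x (Y x) *\<^sub>R p i u + B i x (Y' u))) (at x within S)"
  unfolding B_def
  by (rule has_derivative_eq_rhs[OF has_derivative_add[OF has_derivative_J[OF has_derivative_p[OF assms]]
          has_derivative_scaleR[OF has_derivative_\<eta>[OF assms] has_derivative_p[OF has_derivative_ident]]]])
    (simp add: fun_eq_iff algebra_simps)

lemma has_derivative_\<Gamma>:
  assumes Y: "(Y has_derivative Y') (at x within S)" and Z: "(Z has_derivative Z') (at x within S)"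
  shows "((\<lambda>y. \<Gamma> y (Y y) (Z y)) has_derivative
    (\<lambda>u. \<Gamma>' x u (Y x) (Z x) + \<Gamma> x (Y' u) (Z x) + \<Gamma> x (Y x) (Z' u))) (at x within S)"
proof -
  have "((\<lambda>y. \<Sum>i\<in>UNIV. (Y y \<bullet> p i (Z y)) *\<^sub>R p i y + \<theta> i y (Z y) *\<^sub>R B i y (Y y)
        + \<theta> i y (Y y) *\<^sub>R B i y (Z y)) has_derivative
      (\<lambda>u. \<Sum>i\<in>UNIV. ((Y x \<bullet> p i (Z x)) *\<^sub>R p i u + (Y x \<bullet> p i (Z' u) + Y' u \<bullet> p i (Z x)) *\<^sub>R p i x)
      + (\<theta> i x (Z x) *\<^sub>R (\<eta> i u (Y x) *\<^sub>R p i x + \<eta> i x (Y x) *\<^sub>R p i u + B i x (Y' u))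
        + (\<theta> i u (Z x) + \<theta> i x (Z' u)) *\<^sub>R B i x (Y x))
      + (\<theta> i x (Y x) *\<^sub>R (\<eta> i u (Z x) *\<^sub>R p i x + \<eta> i x (Z x) *\<^sub>R p i u + B i x (Z' u))
        + (\<theta> i u (Y x) + \<theta> i x (Y' u)) *\<^sub>R B i x (Z x)))) (at x within S)"
    by (intro has_derivative_sum has_derivative_add has_derivative_scaleR has_derivative_inner
        has_derivative_p has_derivative_\<theta> has_derivative_B has_derivative_ident assms)
  then show ?thesis
    unfolding \<Gamma>_def \<Gamma>'_def sum.distrib[symmetric]
    by (rule has_derivative_eq_rhs) (simp add: algebra_simps)
qed

lemma conn_cong:
  assumes "X \<in> vector_fields M" "X' \<in> vector_fields M" "Y \<in> vector_fields M" "Y' \<in> vector_fields M"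
    "\<And>x. x \<in> M \<Longrightarrow> X x = X' x" "\<And>x. x \<in> M \<Longrightarrow> Y x = Y' x" "x \<in> M"
  shows "conn X Y x = conn X' Y' x"
proof -
  have "fd Y x (X' x) = fd Y' x (X' x)"
    using assms by (intro fd_cong_on[of Y Y' M]) (auto simp: vector_fields_iff tangent_space_M)
  then show ?thesis
    using assms by (simp add: conn_def)
qed

text \<open>Differentiating \<open>Y y \<bullet> p i y = 0\<close> along \<open>M\<close> shows that
  the normal part of the flat derivative is the negative of that in
  \<open>\<Gamma>_inner_p\<close>.\<close>

lemma conn_vector_field:
  assumes X: "X \<in> vector_fields M" and Y: "Y \<in> vector_fields M"
  shows "conn X Y \<in> vector_fields M"
  unfolding vector_fields_iff
proof (intro conjI ballI)
  show "smooth (conn X Y)"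
    using X Y by (simp add: vector_fields_iff smooth_conn)
  fix x assume x: "x \<in> M"
  have "conn X Y x \<bullet> p i x = 0" for i
  proof -
    have "((\<lambda>y. Y y \<bullet> p i y) has_derivative (\<lambda>u. Y x \<bullet> p i u + fd Y x u \<bullet> p i x)) (at x within M)"
      using Y by (intro has_derivative_inner has_derivative_p has_derivative_ident smooth_has_derivative)
        (simp add: vector_fields_iff)
    moreover have "((\<lambda>y. Y y \<bullet> p i y) has_derivative (\<lambda>u. 0)) (at x within M)"
      using Y by (intro has_derivative_transform[OF x _ has_derivative_const[of 0]])
        (auto simp: vector_fields_iff T_D)
    moreover have "X x \<in> tangent_space M x"
      using X x by (simp add: vector_fields_def)
    ultimately have "Y x \<bullet> p i (X x) + fd Y x (X x) \<bullet> p i x = 0"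
      by (rule derivative_within_tangent_unique)
    then show ?thesis
      by (simp add: conn_def inner_left_distrib \<Gamma>_inner_p[OF x] inner_p_commute[of "Y x"])
  qed
  then show "conn X Y x \<in> T x"
    by (simp add: T_def)
qed

lemma conn_scale:
  assumes f: "smooth f" and X: "X \<in> vector_fields M" and Y: "Y \<in> vector_fields M"
  shows "conn (\<lambda>y. f y *\<^sub>R X y) Y x = f x *\<^sub>R conn X Y x"
    "conn X (\<lambda>y. f y *\<^sub>R Y y) x = f x *\<^sub>R conn X Y x + fd f x (X x) *\<^sub>R Y x"
  using assms
  by (simp_all add: vector_fields_iff conn_def \<Gamma>_scale linear_scale[OF linear_fd] fd_scaleR algebra_simps)

lemma conn_add:
  assumes "X \<in> vector_fields M" "X' \<in> vector_fields M" "Y \<in> vector_fields M"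
  shows "conn (\<lambda>y. X y + X' y) Y x = conn X Y x + conn X' Y x"
    "conn Y (\<lambda>y. X y + X' y) x = conn Y X x + conn Y X' x"
  using assms
  by (simp_all add: vector_fields_iff conn_def \<Gamma>_add linear_add[OF linear_fd] fd_add)

lemma affine_connection_conn: "affine_connection M conn"
  unfolding affine_connection_def
proof (intro conjI ballI allI impI)
  show "conn X Y x = conn X' Y' x"
    if "X \<in> vector_fields M" "X' \<in> vector_fields M" "Y \<in> vector_fields M" "Y' \<in> vector_fields M"
      "\<forall>x\<in>M. X x = X' x \<and> Y x = Y' x" "x \<in> M" for X X' Y Y' x
    using that by (intro conn_cong) auto
qed (simp_all add: conn_vector_field conn_add conn_scale)

lemma torsion_free_conn: "torsion_free M conn"
  by (simp add: torsion_free_def conn_def lie_bracket_def \<Gamma>_commute[of _ "X _" "Y _" for X Y])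

text \<open>The metric of the theorem is a definite description, under control only for tangent
  vectors at points of \<open>M\<close>; no more than that is compared with
  \<open>G\<close>.\<close>

definition agrees :: "('a \<Rightarrow> 'a \<Rightarrow> 'a \<Rightarrow> real) \<Rightarrow> bool" where
  "agrees g \<longleftrightarrow> (\<forall>x\<in>M. \<forall>v\<in>T x. \<forall>w\<in>T x. g x v w = G x v w)"

text \<open>The product rule for \<open>G\<close> gives the derivative \<open>L\<close> within
  \<open>M\<close>, and \<open>g\<close> inherits it because both functions coincide on
  \<open>M\<close>. The variation of the base point is absorbed by
  \<open>G_\<Gamma>_skew\<close>.\<close>

lemma metric_compatible_conn:
  assumes g: "agrees g"
  shows "metric_compatible M g conn"
  unfolding metric_compatible_def
proof (intro ballI)
  fix X Y Z x
  assume X: "X \<in> vector_fields M" and Y: "Y \<in> vector_fields M" and Z: "Z \<in> vector_fields M" and x: "x \<in> M"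
  let ?Y' = "fd Y x" and ?Z' = "fd Z x"
  define L where "L u = (Y x \<bullet> ?Z' u + ?Y' u \<bullet> Z x) + (\<Sum>i\<in>UNIV. \<eta> i x (Y x) * (\<theta> i u (Z x) + \<theta> i x (?Z' u))
      + (\<eta> i u (Y x) + \<eta> i x (?Y' u)) * \<theta> i x (Z x))" for u
  have Y': "(Y has_derivative ?Y') (at x within M)" and Z': "(Z has_derivative ?Z') (at x within M)"
    using Y Z by (simp_all add: vector_fields_iff smooth_has_derivative)
  have G: "((\<lambda>y. G y (Y y) (Z y)) has_derivative L) (at x within M)"
    unfolding G_def L_def
    by (intro has_derivative_add has_derivative_inner has_derivative_sum has_derivative_mult
        has_derivative_\<eta> has_derivative_\<theta> Y' Z')
  have gL: "((\<lambda>y. g y (Y y) (Z y)) has_derivative L) (at x within M)"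
    using g Y Z by (intro has_derivative_transform[OF x _ G]) (auto simp: vector_fields_iff agrees_def)
  have T: "X x \<in> T x" "Y x \<in> T x" "Z x \<in> T x"
    using X Y Z x by (auto simp: vector_fields_iff)
  have "conn X Y x \<in> T x" "conn X Z x \<in> T x"
    using conn_vector_field[OF X Y] conn_vector_field[OF X Z] x by (auto simp: vector_fields_iff)
  then have "g x (conn X Y x) (Z x) + g x (Y x) (conn X Z x)
      = G x (conn X Y x) (Z x) + G x (Y x) (conn X Z x)"
    using g T x by (simp add: agrees_def)
  also have "\<dots> = L (X x)"
    using G_\<Gamma>_skew[OF T]
    by (simp add: conn_def G_add L_def)
      (simp add: G_def inner_commute algebra_simps sum.distrib)
  finally show "\<exists>L. ((\<lambda>y. g y (Y y) (Z y)) has_derivative L) (at x within M) \<and>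
      L (X x) = g x (conn X Y x) (Z x) + g x (Y x) (conn X Z x)"
    using gL by metis
qed

text \<open>The difference \<open>S\<close> of the two connections is symmetric, as both are
  torsion-free, and skew for \<open>G\<close>, as both are metric. Three cyclic instances of the
  skewness force \<open>S\<close> to be orthogonal to every tangent vector.\<close>

lemma levi_civita_unique:
  assumes g: "agrees g" and aff: "affine_connection M D" and tor: "torsion_free M D"
    and comp: "metric_compatible M g D"
    and X: "X \<in> vector_fields M" and Y: "Y \<in> vector_fields M" and x: "x \<in> M"
  shows "D X Y x = conn X Y x"
proof -
  define S where "S X Y = D X Y x - conn X Y x" for X Y
  have DV: "D X Y \<in> vector_fields M" if "X \<in> vector_fields M" "Y \<in> vector_fields M" for X Y
    using affine_connection_vector_field[OF aff that] .
  have at: "X x \<in> T x" if "X \<in> vector_fields M" for X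
    using that x by (simp add: vector_fields_iff)
  have S: "S X Y \<in> T x" if "X \<in> vector_fields M" "Y \<in> vector_fields M" for X Y
    using at[OF DV[OF that]] at[OF conn_vector_field[OF that]]
    by (simp add: S_def T_def inner_diff_left)
  have sym: "S X Y = S Y X" if "X \<in> vector_fields M" "Y \<in> vector_fields M" for X Y
  proof -
    have "D X Y x - D Y X x = conn X Y x - conn Y X x"
      using tor torsion_free_conn that x by (simp add: torsion_free_def)
    then show ?thesis by (simp add: S_def algebra_simps)
  qed
  have skew: "G x (S X Y) (Z x) + G x (S X Z) (Y x) = 0"
    if V: "X \<in> vector_fields M" "Y \<in> vector_fields M" "Z \<in> vector_fields M" for X Y Z
  proof -
    obtain L where L: "((\<lambda>y. g y (Y y) (Z y)) has_derivative L) (at x within M)"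
        "L (X x) = g x (D X Y x) (Z x) + g x (Y x) (D X Z x)"
      using comp[unfolded metric_compatible_def] V x by meson
    obtain L' where L': "((\<lambda>y. g y (Y y) (Z y)) has_derivative L') (at x within M)"
        "L' (X x) = g x (conn X Y x) (Z x) + g x (Y x) (conn X Z x)"
      using metric_compatible_conn[OF g, unfolded metric_compatible_def] V x by meson
    have "L (X x) = L' (X x)"
      using L(1) L'(1) at[OF V(1)] x by (intro derivative_within_tangent_unique) (auto simp: tangent_space_M)
    moreover have "D X Y x \<in> T x" "D X Z x \<in> T x" "conn X Y x \<in> T x" "conn X Z x \<in> T x"
      using V by (auto intro: at DV conn_vector_field)
    ultimately have "G x (D X Y x) (Z x) + G x (Y x) (D X Z x)
        = G x (conn X Y x) (Z x) + G x (Y x) (conn X Z x)"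
      using g at V x by (simp add: L(2) L'(2) agrees_def)
    then show ?thesis
      by (simp add: S_def G_diff G_commute[of x "Y x"])
  qed
  have "S X Y = 0"
  proof (rule G_nondegenerate[OF x S[OF X Y]])
    fix z assume "z \<in> T x"
    then obtain Z where Z: "Z \<in> vector_fields M" "Z x = z"
      using field_exists[OF x] by blast
    show "G x (S X Y) z = 0"
      using skew[OF X Y Z(1)] skew[OF Y Z(1) X] skew[OF Z(1) X Y]
        sym[OF X Y] sym[OF Y Z(1)] sym[OF Z(1) X] Z(2) by simp
  qed
  then show ?thesis by (simp add: S_def)
qed

lemma levi_civita:
  assumes "agrees g"
  shows "affine_connection M (levi_civita M g)" "torsion_free M (levi_civita M g)"
    "metric_compatible M g (levi_civita M g)"
  using affine_connection_conn torsion_free_conn metric_compatible_conn[OF assms]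
    someI[of "\<lambda>D. affine_connection M D \<and> torsion_free M D \<and> metric_compatible M g D" conn]
  unfolding levi_civita_def by simp_all

text \<open>By vanishing torsion the bracket is a difference of two values of \<open>conn\<close>,
  which are tangent.\<close>

lemma lie_bracket_vector_field:
  assumes "X \<in> vector_fields M" "Y \<in> vector_fields M"
  shows "lie_bracket X Y \<in> vector_fields M"
  unfolding vector_fields_iff
proof (intro conjI ballI)
  show "smooth (lie_bracket X Y)"
    using assms unfolding lie_bracket_def[abs_def] vector_fields_iff by (intro smooth_minus smooth_fd_along) auto
  fix x assume x: "x \<in> M"
  have "lie_bracket X Y x = conn X Y x - conn Y X x"
    using torsion_free_conn assms x by (simp add: torsion_free_def)
  then show "lie_bracket X Y x \<in> T x"
    using conn_vector_field[OF assms] conn_vector_field[OF assms(2,1)] x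
    by (simp add: vector_fields_iff T_def inner_diff_left)
qed

lemma fd_conn:
  assumes "smooth Y" "smooth Z"
  shows "fd (conn Y Z) x u = fd (\<lambda>y. fd Z y (Y x)) x u + fd Z x (fd Y x u)
    + (\<Gamma>' x u (Y x) (Z x) + \<Gamma> x (fd Y x u) (Z x) + \<Gamma> x (Y x) (fd Z x u))"
proof -
  have "fd (\<lambda>y. \<Gamma> y (Y y) (Z y)) x u
      = \<Gamma>' x u (Y x) (Z x) + \<Gamma> x (fd Y x u) (Z x) + \<Gamma> x (Y x) (fd Z x u)"
    using assms by (subst fd_eq[OF has_derivative_\<Gamma>[OF smooth_has_derivative smooth_has_derivative]]) auto
  moreover have "fd (conn Y Z) x u = fd (\<lambda>y. fd Z y (Y y)) x u + fd (\<lambda>y. \<Gamma> y (Y y) (Z y)) x u"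
    unfolding conn_def[abs_def] by (rule fd_add) (intro smooth_fd_along smooth_\<Gamma> smooth_id assms)+
  ultimately show ?thesis
    using fd_fd_along[OF assms] by simp
qed

text \<open>Second derivatives of \<open>Z\<close> cancel by Schwarz's theorem, and the terms with
  derivatives of \<open>X\<close> and \<open>Y\<close> cancel against the bracket. What is left
  depends on the values at \<open>x\<close> only.\<close>

lemma curvature_levi_civita:
  assumes g: "agrees g" and X: "X \<in> vector_fields M" and Y: "Y \<in> vector_fields M"
    and Z: "Z \<in> vector_fields M" and x: "x \<in> M"
  shows "curvature (levi_civita M g) X Y Z x = riemann x (X x) (Y x) (Z x)"
proof -
  let ?D = "levi_civita M g"
  note lc = levi_civita[OF g]
  have D: "?D X Y x = conn X Y x"
    if "X \<in> vector_fields M" "Y \<in> vector_fields M" "x \<in> M" for X Y x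
    using levi_civita_unique[OF g lc] that by blast
  have DV: "?D X Y \<in> vector_fields M" if "X \<in> vector_fields M" "Y \<in> vector_fields M" for X Y
    using affine_connection_vector_field[OF lc(1) that] .
  \<comment> \<open>The inner derivative equals \<open>conn Y Z\<close> on \<open>M\<close> only, so
    the outer one is rewritten through \<open>conn_cong\<close>.\<close>
  have DD: "?D X (?D Y Z) x = conn X (conn Y Z) x"
    if "X \<in> vector_fields M" "Y \<in> vector_fields M" for X Y
    using that Z x by (subst D) (auto intro!: conn_cong DV conn_vector_field D)
  have s: "smooth X" "smooth Y" "smooth Z"
    using X Y Z by (simp_all add: vector_fields_iff)
  have DDe: "conn X (conn Y Z) x = fd (\<lambda>y. fd Z y (Y x)) x (X x) + fd Z x (fd Y x (X x))
    + \<Gamma>' x (X x) (Y x) (Z x) + \<Gamma> x (fd Y x (X x)) (Z x) + \<Gamma> x (Y x) (fd Z x (X x))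
    + \<Gamma> x (X x) (fd Z x (Y x)) + \<Gamma> x (X x) (\<Gamma> x (Y x) (Z x))"
    if "smooth X" "smooth Y" for X Y
    using that s(3) by (simp add: conn_def[of X] fd_conn) (simp add: conn_def \<Gamma>_add)
  have "curvature ?D X Y Z x = conn X (conn Y Z) x - conn Y (conn X Z) x - conn (lie_bracket X Y) Z x"
    using D[OF lie_bracket_vector_field[OF X Y] Z x] DD X Y by (simp add: curvature_def)
  then show ?thesis
    using fd_fd_symmetric[OF s(3), of "Y x" x "X x"]
    by (simp add: DDe s riemann_def conn_def[of "lie_bracket X Y"] lie_bracket_def \<Gamma>_diff
        linear_diff[OF linear_fd[OF s(3)]])
qed

lemma riemann_tangent:
  assumes x: "x \<in> M" and "u \<in> T x" "v \<in> T x" "w \<in> T x"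
  shows "riemann x u v w \<in> T x"
proof -
  obtain X Y Z where V: "X \<in> vector_fields M" "Y \<in> vector_fields M" "Z \<in> vector_fields M"
      and xyz: "X x = u" "Y x = v" "Z x = w"
    using field_exists assms by metis
  have "agrees G" by (simp add: agrees_def)
  note lc = levi_civita(1)[OF this] and c = curvature_levi_civita[OF this V x]
  have DV: "levi_civita M G X Y \<in> vector_fields M" if "X \<in> vector_fields M" "Y \<in> vector_fields M" for X Y
    using affine_connection_vector_field[OF lc that] .
  have D: "levi_civita M G X Y x \<in> T x" if "X \<in> vector_fields M" "Y \<in> vector_fields M" for X Y
    using DV[OF that] x by (simp add: vector_fields_iff)
  have "curvature (levi_civita M G) X Y Z x \<in> T x"
    using D[OF V(1) DV[OF V(2,3)]] D[OF V(2) DV[OF V(1,3)]] D[OF lie_bracket_vector_field[OF V(1,2)] V(3)]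
    by (simp add: curvature_def T_def inner_diff_left)
  then show ?thesis
    by (simp add: c xyz)
qed

end

section \<open>The Ricci tensor\<close>

text \<open>The trace over the chosen basis of \<open>V\<close> is turned into an ambient trace by
  extending \<open>L\<close> to \<open>L'\<close> and composing with a projection \<open>P\<close>
  onto \<open>V\<close>.\<close>

lemma trace_on_eq:
  assumes V: "subspace V" and P: "linear P" "\<And>v. P v \<in> V" "\<And>v. v \<in> V \<Longrightarrow> P v = v"
    and L: "linear L'" "\<And>v. v \<in> V \<Longrightarrow> L v = L' v" "\<And>v. v \<in> V \<Longrightarrow> L v \<in> V"
  shows "trace_on V L = (\<Sum>e\<in>Basis. L' (P e) \<bullet> e)"
proof -
  define B where "B = (SOME B. independent B \<and> span B = V)"
  have "\<exists>B. independent B \<and> span B = V"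
    by (metis V basis_exists span_subspace)
  then have B: "independent B" "span B = V"
    unfolding B_def by (metis (mono_tags, lifting) someI_ex)+
  have fin: "finite B"
    using B(1) by (rule independent_imp_finite)
  \<comment> \<open>Coordinates are linear on the span of \<open>B\<close> only; precomposing with
    \<open>P\<close> makes them linear everywhere and so expandable over
    \<open>Basis\<close>.\<close>
  have lin: "linear (\<lambda>y. representation B (P y) b)" for b
    using P B by (intro linearI) (simp_all add: linear_add[OF P(1)] linear_scale[OF P(1)]
        representation_add representation_scale)
  have rep: "representation B y b = (\<Sum>e\<in>Basis. (y \<bullet> e) * representation B (P e) b)" if "y \<in> V" for y b
    using linear_eq_sum_Basis[OF lin, of y b] P(3)[OF that] by simp
  have BV: "b \<in> V" if "b \<in> B" for b
    using B(2) span_base[OF that] by simp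
  have "trace_on V L = (\<Sum>b\<in>B. representation B (L' b) b)"
    unfolding trace_on_def B_def[symmetric] Let_def by (simp add: L(2) BV)
  also have "\<dots> = (\<Sum>b\<in>B. \<Sum>e\<in>Basis. (L' b \<bullet> e) * representation B (P e) b)"
    by (intro sum.cong[OF refl] rep) (metis L(2,3) BV)
  also have "\<dots> = (\<Sum>e\<in>Basis. (\<Sum>b\<in>B. representation B (P e) b *\<^sub>R L' b) \<bullet> e)"
    by (subst sum.swap) (simp add: inner_sum_left mult.commute)
  also have "\<dots> = (\<Sum>e\<in>Basis. L' (\<Sum>b\<in>B. representation B (P e) b *\<^sub>R b) \<bullet> e)"
    by (simp add: linear_sum[OF L(1)] linear_scale[OF L(1)])
  also have "\<dots> = (\<Sum>e\<in>Basis. L' (P e) \<bullet> e)"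
    using B P(2) fin by (simp add: sum_representation_eq)
  finally show ?thesis .
qed

context odd_spheres
begin

definition d :: "'i \<Rightarrow> real" where
  "d i = (\<Sum>e\<in>Basis. e \<bullet> p i e)"

definition P :: "'a \<Rightarrow> 'a \<Rightarrow> 'a" where
  "P x v = v - (\<Sum>i\<in>UNIV. (v \<bullet> p i x) *\<^sub>R p i x)"

text \<open>Meant also for maps that do not preserve \<open>T x\<close>, so that the curvature can
  be split into summands traced one by one.\<close>

definition tr :: "'a \<Rightarrow> ('a \<Rightarrow> 'a) \<Rightarrow> real" where
  "tr x L = (\<Sum>e\<in>Basis. L (P x e) \<bullet> e)"

lemma linear_P: "linear (P x)"
  by (rule linearI) (simp_all add: P_def inner_left_distrib algebra_simps sum.distrib scaleR_sum_right)

lemmas P_simps [simp] = linear_add[OF linear_P] linear_diff[OF linear_P] linear_scale[OF linear_P]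
  linear_0[OF linear_P]

lemma P_T: "x \<in> M \<Longrightarrow> P x v \<in> T x"
  using M_D[of x] by (simp add: T_def P_def inner_diff_left inner_sum_left
      if_distrib[of "inner _"] if_distrib[of "(*) _"] cong: if_cong)

lemma P_id: "v \<in> T x \<Longrightarrow> P x v = v"
  using T_D[of v x] by (simp add: P_def)

lemma P_normal:
  assumes "x \<in> M" shows "P x (p i x) = 0"
  using M_D[OF assms] by (simp add: P_def inner_p_commute[of _ i] if_distrib[of "inner _"]
      if_distrib[of "\<lambda>r. r *\<^sub>R _"] cong: if_cong)

lemma subspace_T: "subspace (T x)"
  by (simp add: subspace_def T_def inner_left_distrib)

lemma p_T: "v \<in> T x \<Longrightarrow> p i v \<in> T x"
  by (auto simp: T_def)

lemma B_T: "x \<in> M \<Longrightarrow> B i x v \<in> T x"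
  by (simp add: T_def B_inner_p)

lemma tr_add: "tr x (\<lambda>u. f u + g u) = tr x f + tr x g"
  by (simp add: tr_def inner_left_distrib sum.distrib)

lemma tr_diff: "tr x (\<lambda>u. f u - g u) = tr x f - tr x g"
  by (simp add: tr_def inner_diff_left sum_subtractf)

lemma tr_minus: "tr x (\<lambda>u. - f u) = - tr x f"
  by (simp add: tr_def sum_negf)

lemma tr_scale: "tr x (\<lambda>u. r *\<^sub>R f u) = r * tr x f"
  by (simp add: tr_def sum_distrib_left)

lemma tr_sum: "tr x (\<lambda>u. \<Sum>i\<in>S. f i u) = (\<Sum>i\<in>S. tr x (f i))"
  by (simp add: tr_def inner_sum_left) (rule sum.swap)

text \<open>Only the tangential part of \<open>y\<close> contributes; by \<open>P_normal\<close>,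
  summands with values along \<open>p i x\<close> drop out of all the traces below.\<close>

lemma tr_rank_one:
  assumes f: "linear f"
  shows "tr x (\<lambda>u. f u *\<^sub>R y) = f (P x y)"
proof -
  have "linear (\<lambda>u. f (P x u))"
    using linear_compose[OF linear_P f] by (simp add: o_def)
  from linear_eq_sum_Basis[OF this, of y] show ?thesis
    by (simp add: tr_def mult.commute)
qed

lemma sum_Basis_inner: "(\<Sum>e\<in>Basis. (e \<bullet> v) * (e \<bullet> w)) = v \<bullet> w"
  by (simp add: euclidean_inner[of v w] inner_commute)

lemma tr_p:
  assumes x: "x \<in> M" shows "tr x (p i) = d i - 1"
proof -
  have "tr x (p i) = (\<Sum>e\<in>Basis. e \<bullet> p i e - (e \<bullet> p i x) * (e \<bullet> p i x))"
    unfolding tr_def by (intro sum.cong refl)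
      (simp add: P_def inner_diff_left inner_sum_left inner_p_commute[of x]
        if_distrib[of "\<lambda>z. inner z _"] if_distrib[of "(*) _"] cong: if_cong)
  then show ?thesis
    using sum_Basis_inner[of "p i x" "p i x"] M_D[OF x] by (simp add: sum_subtractf d_def)
qed

text \<open>The diagonal vanishes by skew-symmetry, and the normal direction removed by
  \<open>P\<close> is sent by \<open>J\<close> to an orthogonal vector.\<close>

lemma tr_Jp:
  assumes x: "x \<in> M" shows "tr x (\<lambda>u. J (p i u)) = 0"
proof -
  have "tr x (\<lambda>u. J (p i u)) = (\<Sum>e\<in>Basis. - ((e \<bullet> p i x) * (e \<bullet> J (p i x))))"
    unfolding tr_def by (intro sum.cong refl)
      (simp add: P_def inner_diff_left inner_sum_left inner_Jp_commute[of x] if_distrib[of "\<lambda>z. inner z _"]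
        if_distrib[of "(*) _"] if_distrib[of J] cong: if_cong)
  then show ?thesis
    using sum_Basis_inner[of "p i x" "J (p i x)"] by (simp add: sum_negf)
qed

lemma \<eta>_linear_base [simp]:
  "\<eta> i (x + y) v = \<eta> i x v + \<eta> i y v" "\<eta> i (r *\<^sub>R x) v = r * \<eta> i x v" "\<eta> i 0 v = 0"
  by (simp_all add: \<eta>_def inner_right_distrib)

lemma \<theta>_linear_base [simp]:
  "\<theta> i (x + y) v = \<theta> i x v + \<theta> i y v" "\<theta> i (r *\<^sub>R x) v = r * \<theta> i x v" "\<theta> i 0 v = 0"
  by (simp_all add: \<theta>_def algebra_simps sum.distrib sum_distrib_left)

lemma linear_forms:
  "linear (\<lambda>u. \<eta> i u v)" "linear (\<lambda>u. \<theta> i u v)" "linear (\<eta> i x)" "linear (\<theta> i x)"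
  "linear (\<lambda>u. u \<bullet> v)" "linear (\<lambda>u. v \<bullet> p i (\<Gamma> x u w))" "linear (\<lambda>u. \<theta> i x (\<Gamma> x u w))"
  "linear (\<lambda>u. \<eta> i x (\<Gamma> x u w))"
  by (auto intro!: linearI simp: inner_left_distrib inner_right_distrib \<Gamma>_add \<Gamma>_scale)

lemmas tr_simps = tr_add tr_diff tr_minus tr_scale tr_sum tr_rank_one[OF linear_forms(1)]
  tr_rank_one[OF linear_forms(2)] tr_rank_one[OF linear_forms(3)] tr_rank_one[OF linear_forms(4)]
  tr_rank_one[OF linear_forms(5)] tr_rank_one[OF linear_forms(6)] tr_rank_one[OF linear_forms(7)]
  tr_rank_one[OF linear_forms(8)]

lemma linear_riemann: "linear (\<lambda>u. riemann x u v w)"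
proof -
  have 1: "\<Gamma>' x (u + u') v w = \<Gamma>' x u v w + \<Gamma>' x u' v w" "\<Gamma>' x (r *\<^sub>R u) v w = r *\<^sub>R \<Gamma>' x u v w" for u u' r
    by (simp_all add: \<Gamma>'_def algebra_simps sum.distrib[symmetric] scaleR_sum_right)
  have 2: "\<Gamma>' x v (u + u') w = \<Gamma>' x v u w + \<Gamma>' x v u' w" "\<Gamma>' x v (r *\<^sub>R u) w = r *\<^sub>R \<Gamma>' x v u w" for u u' r
    by (simp_all add: \<Gamma>'_def algebra_simps inner_left_distrib sum.distrib[symmetric] scaleR_sum_right)
  show ?thesis
    by (rule linearI) (simp_all add: riemann_def 1 2 \<Gamma>_add \<Gamma>_scale algebra_simps)
qed

lemma p_B: "p j (B i x v) = (if i = j then B i x v else 0)"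
  by (simp add: B_def)

lemma J_B: "J (B i x v) = \<eta> i x v *\<^sub>R J (p i x) - p i v"
  by (simp add: B_def)

definition q :: "'i \<Rightarrow> 'a \<Rightarrow> 'a \<Rightarrow> 'a \<Rightarrow> real" where
  "q i x v w = v \<bullet> p i w - \<eta> i x v * \<eta> i x w"

text \<open>The \<open>J\<close> inside \<open>\<eta>\<close> undoes the rotation in
  \<open>B\<close> up to sign, which leaves \<open>q\<close>. Only the diagonal entry of
  \<open>k\<close> survives, because \<open>B i x v\<close> lies in the range of
  \<open>p i\<close>.\<close>

lemma \<theta>_at_B: "\<theta> i (B i x v) w = - k i i * q i x v w"
proof -
  have "\<eta> j (B i x v) w = (if i = j then - q i x v w else 0)" for j
    by (simp add: \<eta>_def[of j "B i x v"] p_B J_B q_def inner_diff_right inner_p_commute[of w])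
      (simp add: \<eta>_def)
  then show ?thesis
    by (simp add: \<theta>_def if_distrib[of "(*) _"] cong: if_cong)
qed

lemma \<theta>_of_B:
  assumes v: "v \<in> T x"
  shows "\<theta> i v (B i x w) = k i i * q i x v w"
proof -
  have "B i x w \<bullet> J (p j v) = (if i = j then q i x v w else 0)" for j
    by (simp add: B_def inner_left_distrib q_def inner_p_commute[of w] inner_Jp_commute[of x _ v])
      (simp add: \<eta>_def)
  then show ?thesis
    by (simp add: \<theta>_def \<eta>_def if_distrib[of "(*) _"] cong: if_cong)
qed

lemma tr_B: "x \<in> M \<Longrightarrow> tr x (B i x) = 0"
  by (simp add: B_def[abs_def] tr_simps tr_Jp P_normal)

lemma tr_\<Gamma>'_1:
  assumes x: "x \<in> M"
  shows "tr x (\<lambda>u. \<Gamma>' x u v w) = (\<Sum>i\<in>UNIV. (d i - 1) * (v \<bullet> p i w) - 2 * k i i * q i x v w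
    + (d i - 1) * (\<theta> i x w * \<eta> i x v + \<theta> i x v * \<eta> i x w))"
proof -
  have "q i x w v = q i x v w" for i
    by (simp add: q_def inner_p_commute[of w] mult.commute)
  then show ?thesis
    by (simp add: \<Gamma>'_def tr_simps tr_p x P_normal P_id B_T \<theta>_at_B) (simp add: algebra_simps)
qed

lemma tr_\<Gamma>'_2:
  assumes x: "x \<in> M" and v: "v \<in> T x"
  shows "tr x (\<lambda>u. \<Gamma>' x v u w) = (\<Sum>i\<in>UNIV. v \<bullet> p i w + \<theta> i x w * \<eta> i x v
    + k i i * q i x v w + k i i * \<eta> i x v * \<eta> i x w)"
proof -
  have "\<theta> i x (p i v) = k i i * \<eta> i x v" for i
    by (simp add: \<theta>_def \<eta>_p' if_distrib[of "(*) _"] cong: if_cong)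
  then show ?thesis
    by (simp add: \<Gamma>'_def tr_simps tr_B x v P_normal P_id B_T p_T \<theta>_of_B \<eta>_p')
      (simp add: algebra_simps)
qed

text \<open>Here \<open>z\<close> will be \<open>\<Gamma> x v w\<close>, which is not tangent; its
  normal part, known from \<open>\<Gamma>_inner_p\<close>, is all that counts.\<close>

lemma tr_\<Gamma>:
  assumes x: "x \<in> M"
  shows "tr x (\<lambda>u. \<Gamma> x u z) = (\<Sum>i\<in>UNIV. k i i * (z \<bullet> p i x))"
proof -
  have "\<eta> j x (B i x z) = (if i = j then z \<bullet> p i x else 0)" for i j
    by (simp add: \<eta>_def[of j] p_B J_B) (simp add: B_def inner_left_distrib M_D[OF x])
  then have "\<theta> i x (B i x z) = k i i * (z \<bullet> p i x)" for i
    by (simp add: \<theta>_def if_distrib[of "(*) _"] cong: if_cong)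
  then show ?thesis
    by (simp add: \<Gamma>_def tr_simps tr_B x P_normal P_id B_T)
qed

lemma tr_\<Gamma>_\<Gamma>:
  assumes x: "x \<in> M" and v: "v \<in> T x" and w: "w \<in> T x"
  shows "tr x (\<lambda>u. \<Gamma> x v (\<Gamma> x u w))
    = (\<Sum>i\<in>UNIV. \<theta> i x v * \<eta> i x w - (d i - 2) * \<theta> i x v * \<theta> i x w)"
proof -
  have \<theta>p: "\<theta> i x (p i v) = k i i * \<eta> i x v" for i v
    by (simp add: \<theta>_def \<eta>_p' if_distrib[of "(*) _"] cong: if_cong)
  have p\<Gamma>: "p i (\<Gamma> x u w) = (u \<bullet> p i w) *\<^sub>R p i x + \<theta> i x w *\<^sub>R B i x u + \<theta> i x u *\<^sub>R B i x w" for i u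
    by (simp add: \<Gamma>_def p_B if_distrib[of "(*\<^sub>R) _"] sum.distrib cong: if_cong)
  have "tr x (\<lambda>u. J (p i (\<Gamma> x u w))) = \<eta> i x w - (d i - 2) * \<theta> i x w" for i
    by (simp add: p\<Gamma> J_B tr_simps tr_p x P_id Jp_T p_T w \<eta>_Jp \<theta>_Jp \<theta>p)
      (simp add: \<eta>_def algebra_simps inner_Jp_commute[of _ i w])
  moreover have "B i x (\<Gamma> x u w) = J (p i (\<Gamma> x u w)) + \<eta> i x (\<Gamma> x u w) *\<^sub>R p i x" for i u
    by (simp add: B_def)
  \<comment> \<open>The map
    \<open>u \<mapsto> \<theta> i x (\<Gamma> x u w) *\<^sub>R B i x v\<close> has rank one, so its
    trace is the form evaluated at the tangent vector \<open>B i x v\<close>.\<close>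
  moreover have "\<theta> i x (\<Gamma> x (B i x v) w) = 0" for i
    by (rule \<theta>_\<Gamma>[OF B_T[OF x] w])
  ultimately show ?thesis
    by (simp add: \<Gamma>_def[of x v] tr_simps x P_normal P_id B_T \<Gamma>_def[of x 0]) (simp add: algebra_simps)
qed

text \<open>The curvature depends on point values only, so the choice made by
  \<open>field_through\<close> is immaterial, and the Ricci tensor is the sum of the four traces
  above. In it \<open>k i i\<close> multiplies \<open>q\<close> with total coefficient
  \<open>-2\<close>: the traces of \<open>\<Gamma>'\<close> give \<open>-3\<close>, the trace of
  \<open>\<Gamma>\<close> gives \<open>+1\<close>.\<close>

theorem ricci_eq:
  assumes g: "agrees g" and x: "x \<in> M" and v: "v \<in> T x" and w: "w \<in> T x"
  shows "ricci M g x v w = (\<Sum>i\<in>UNIV. (d i - 2) * (\<eta> i x v + \<theta> i x v) * (\<eta> i x w + \<theta> i x w)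
    + (d i - 2 - 2 * k i i) * q i x v w)"
proof -
  have F: "field_through M x u \<in> vector_fields M \<and> field_through M x u x = u" if "u \<in> T x" for u
  proof -
    have "\<exists>X. X \<in> vector_fields M \<and> X x = u"
      using field_exists[OF x that] by (simp add: Bex_def)
    from someI_ex[OF this] show ?thesis
      by (simp only: field_through_def)
  qed
  have c: "curvature (levi_civita M g) (field_through M x u) (field_through M x v) (field_through M x w) x
      = riemann x u v w" if "u \<in> T x" for u
    using curvature_levi_civita[OF g F[OF that, THEN conjunct1] F[OF v, THEN conjunct1]
        F[OF w, THEN conjunct1] x] F[OF that] F[OF v] F[OF w] by simp
  have "ricci M g x v w = tr x (\<lambda>u. riemann x u v w)"
    unfolding ricci_def tangent_space_M[OF x] tr_def
    by (rule trace_on_eq[OF subspace_T linear_P P_T[OF x] P_id linear_riemann])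
      (simp_all add: c riemann_tangent[OF x _ v w])
  also have "\<dots> = tr x (\<lambda>u. \<Gamma>' x u v w) - tr x (\<lambda>u. \<Gamma>' x v u w) + tr x (\<lambda>u. \<Gamma> x u (\<Gamma> x v w))
      - tr x (\<lambda>u. \<Gamma> x v (\<Gamma> x u w))"
    unfolding riemann_def tr_diff tr_add by simp
  also have "\<dots> = (\<Sum>i\<in>UNIV. (d i - 2) * (\<eta> i x v + \<theta> i x v) * (\<eta> i x w + \<theta> i x w)
    + (d i - 2 - 2 * k i i) * q i x v w)"
    unfolding tr_\<Gamma>'_1[OF x] tr_\<Gamma>'_2[OF x v] tr_\<Gamma>[OF x] tr_\<Gamma>_\<Gamma>[OF x v w] \<Gamma>_inner_p[OF x]
      sum_subtractf[symmetric] sum.distrib[symmetric]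
    by (intro sum.cong refl) (simp add: q_def algebra_simps)
  finally show ?thesis .
qed

end

section \<open>Unitary matrices\<close>

lemma inner_matrix_vector_mult:
  fixes A :: "'m::finite cmat"
  shows "(A *v v) \<bullet> w = v \<bullet> (transpose (map_matrix cnj A) *v w)"
proof -
  have c: "(a * b) \<bullet> c = b \<bullet> (cnj a * c)" for a b c :: complex
    by (simp add: inner_complex_def algebra_simps)
  have "(A *v v) \<bullet> w = (\<Sum>r\<in>UNIV. \<Sum>s\<in>UNIV. v $ s \<bullet> (cnj (A $ r $ s) * w $ r))"
    by (simp add: inner_vec_def matrix_vector_mult_def inner_sum_left c)
  also have "\<dots> = v \<bullet> (transpose (map_matrix cnj A) *v w)"
    by (subst sum.swap)
      (simp add: inner_vec_def matrix_vector_mult_def inner_sum_right transpose_def map_matrix_def)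
  finally show ?thesis .
qed

lemma matrix_vector_mult_axis [simp]:
  fixes A :: "'m::finite cmat"
  shows "(A *v axis k 1) $ r = A $ r $ k"
  by (simp add: matrix_vector_mult_def axis_def if_distrib[of "(*) _"] cong: if_cong)

lemma unitary_inner:
  assumes "U \<in> unitary_group"
  shows "(U *v v) \<bullet> (U *v w) = v \<bullet> w"
  using assms by (simp add: inner_matrix_vector_mult matrix_vector_mul_assoc unitary_group_def)

lemma unitary_surj:
  assumes "U \<in> unitary_group"
  shows "\<exists>w. U *v w = v"
proof -
  have "U ** transpose (map_matrix cnj U) = mat 1"
    using assms by (simp add: unitary_group_def matrix_left_right_inverse)
  then have "U *v (transpose (map_matrix cnj U) *v v) = v"
    by (metis matrix_vector_mul_assoc matrix_vector_mul_lid)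
  then show ?thesis ..
qed

text \<open>If \<open>h\<close> denotes the Hermitian product and \<open>u = e\<^sub>0 - x\<close>, then the complex reflection
  \<open>v \<mapsto> v - (h u v / h u e\<^sub>0) u\<close> maps \<open>e\<^sub>0\<close> to \<open>x\<close>; it is unitary because
  \<open>h u u = 2 Re (h u e\<^sub>0)\<close> for unit vectors \<open>x\<close>.\<close>

lemma unitary_transitive:
  fixes x :: "'m::{finite,zero} cvec"
  assumes x: "norm x = 1"
  shows "\<exists>U\<in>unitary_group. U *v axis 0 1 = x"
proof -
  \<comment> \<open>In the notation above, \<open>\<beta>\<close> is the denominator
    \<open>h u e\<^sub>0\<close>.\<close>
  define \<beta> where "\<beta> = 1 - cnj (x $ 0)"
  define u where "u = axis 0 1 - x"
  have xx: "(\<Sum>r\<in>UNIV. (cmod (x $ r))\<^sup>2) = 1"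
    using x by (simp add: norm_vec_def L2_set_def)
  show ?thesis
  proof (cases "\<beta> = 0")
    \<comment> \<open>The reflection is undefined here, but \<open>x $ 0 = 1\<close> and the unit
      norm force \<open>x\<close> to be the axis vector, so the identity matrix serves.\<close>
    case True
    then have x0: "x $ 0 = 1"
      by (simp add: \<beta>_def complex_eq_iff)
    have "(\<Sum>r\<in>UNIV - {0}. (cmod (x $ r))\<^sup>2) = 0"
      using xx x0 by (simp add: sum.remove[of UNIV 0])
    then have "x $ r = 0" if "r \<noteq> 0" for r
      using that by (simp add: sum_nonneg_eq_0_iff)
    then have "x = axis 0 1"
      using x0 by (auto simp: vec_eq_iff axis_def)
    moreover have "mat 1 \<in> (unitary_group :: 'm cmat set)"
    proof -
      have "map_matrix cnj (mat 1 :: 'm cmat) = mat 1"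
        by (simp add: map_matrix_def mat_def vec_eq_iff)
      then show ?thesis by (simp add: unitary_group_def)
    qed
    ultimately show ?thesis
      by (metis matrix_vector_mul_lid)
  next
    case False
    define U :: "'m cmat" where "U = (\<chi> r s. (if r = s then 1 else 0) - u $ r * cnj (u $ s) / \<beta>)"
    have uu: "(\<Sum>r\<in>UNIV. cnj (u $ r) * u $ r) = \<beta> + cnj \<beta>"
    proof -
      have "(\<Sum>r\<in>UNIV. cnj (u $ r) * u $ r)
        = (\<Sum>r\<in>UNIV. (if r = 0 then 1 - cnj (x $ 0) - x $ 0 else 0) + of_real ((cmod (x $ r))\<^sup>2))"
        by (intro sum.cong refl) (simp add: u_def axis_def complex_norm_square algebra_simps del: of_real_power)
      also have "\<dots> = \<beta> + cnj \<beta>"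
        using arg_cong[OF xx, of complex_of_real] by (simp add: sum.distrib \<beta>_def)
      finally show ?thesis .
    qed
    have "(transpose (map_matrix cnj U) ** U) $ r $ s = mat 1 $ r $ s" for r s
    proof -
      have "(transpose (map_matrix cnj U) ** U) $ r $ s = (\<Sum>t\<in>UNIV. cnj (U $ t $ r) * U $ t $ s)"
        by (simp add: matrix_matrix_mult_def transpose_def map_matrix_def)
      \<comment> \<open>The product is sorted into two Kronecker terms, each collapsing to one
        index, and a term carrying \<open>cnj (u $ t) * u $ t\<close>, which is summed by
        \<open>uu\<close>.\<close>
      also have "\<dots> = (\<Sum>t\<in>UNIV.
          (if t = r then (if r = s then 1 else 0) - u $ r * cnj (u $ s) / \<beta> else 0)
          - (if t = s then cnj (u $ s) * u $ r / cnj \<beta> else 0)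
          + (u $ r * cnj (u $ s) / (\<beta> * cnj \<beta>)) * (cnj (u $ t) * u $ t))"
        using False by (intro sum.cong refl) (auto simp: U_def field_simps)
      also have "\<dots> = (if r = s then 1 else 0) - u $ r * cnj (u $ s) / \<beta> - cnj (u $ s) * u $ r / cnj \<beta>
          + (u $ r * cnj (u $ s) / (\<beta> * cnj \<beta>)) * (\<beta> + cnj \<beta>)"
        unfolding sum.distrib sum_subtractf sum_distrib_left[symmetric] uu by simp
      also have "\<dots> = mat 1 $ r $ s"
        using False by (simp add: mat_def field_simps)
      finally show ?thesis .
    qed
    then have "U \<in> unitary_group"
      by (simp add: unitary_group_def vec_eq_iff)
    moreover have "U *v axis 0 1 = x"
    proof -
      have "cnj (u $ 0) = \<beta>"
        by (simp add: u_def \<beta>_def)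
      then show ?thesis
        using False by (auto simp: vec_eq_iff U_def) (auto simp: u_def axis_def)
    qed
    ultimately show ?thesis by blast
  qed
qed

section \<open>The homogeneous structures on the product of two spheres\<close>

definition cJ :: "'m::finite cvec \<times> 'k::finite cvec \<Rightarrow> 'm cvec \<times> 'k cvec" where
  "cJ v = (\<i> *s fst v, \<i> *s snd v)"

definition cp :: "bool \<Rightarrow> 'm::finite cvec \<times> 'k::finite cvec \<Rightarrow> 'm cvec \<times> 'k cvec" where
  "cp i v = (if i then (fst v, 0) else (0, snd v))"

text \<open>The matrix of \<open>g(a,c)\<close> on \<open>X1\<close>, \<open>X2\<close> minus the
  identity, since these correspond to the unit Hopf vectors at the base point. The index
  \<open>True\<close> stands for the first sphere.\<close>

definition ck :: "real \<Rightarrow> real \<Rightarrow> bool \<Rightarrow> bool \<Rightarrow> real" where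
  "ck a c i j = (if i = j then (if i then 1 / c else (a\<^sup>2 + c\<^sup>2) / c) - 1 else - a / c)"

locale sphere_pair =
  fixes a c :: real and tm :: "'m::{finite,zero} itself" and tk :: "'k::{finite,zero} itself"
  assumes c_pos: "c > 0"
begin

lemma inner_ii: "(\<i> *s v) \<bullet> (\<i> *s w) = v \<bullet> w" for v w :: "'n::finite cvec"
  by (simp add: inner_vec_def inner_complex_def add.commute)

sublocale odd_spheres "cJ :: 'm cvec \<times> 'k cvec \<Rightarrow> 'm cvec \<times> 'k cvec" cp "ck a c"
proof (rule odd_spheres.intro)
  show "linear (cJ :: 'm cvec \<times> 'k cvec \<Rightarrow> 'm cvec \<times> 'k cvec)"
    by (rule linearI) (simp_all add: cJ_def vec_eq_iff algebra_simps scaleR_conv_of_real)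
  show "cJ (cJ v) = - v" for v :: "'m cvec \<times> 'k cvec"
    by (simp add: cJ_def vec_eq_iff prod_eq_iff)
  show "cJ v \<bullet> cJ w = v \<bullet> w" for v w :: "'m cvec \<times> 'k cvec"
    by (simp add: cJ_def inner_prod_def inner_ii)
  show "linear (cp i :: 'm cvec \<times> 'k cvec \<Rightarrow> 'm cvec \<times> 'k cvec)" for i
    by (rule linearI) (simp_all add: cp_def)
  show "cp i v \<bullet> w = v \<bullet> cp i w" for i and v w :: "'m cvec \<times> 'k cvec"
    by (simp add: cp_def inner_prod_def)
  show "cp i (cp j v) = (if i = j then cp i v else 0)" for i j and v :: "'m cvec \<times> 'k cvec"
    by (auto simp: cp_def prod_eq_iff)
  show "(\<Sum>i\<in>UNIV. cp i v) = v" for v :: "'m cvec \<times> 'k cvec"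
    by (simp add: cp_def UNIV_bool prod_eq_iff)
  show "cp i (cJ v) = cJ (cp i v)" for i and v :: "'m cvec \<times> 'k cvec"
    by (simp add: cp_def cJ_def vec_eq_iff)
  show "ck a c i j = ck a c j i" for i j
    by (auto simp: ck_def)
  fix s :: "bool \<Rightarrow> real" and i
  assume s: "\<And>j. s j + (\<Sum>i\<in>UNIV. s i * ck a c i j) = 0"
  \<comment> \<open>Identity plus \<open>ck a c\<close> has determinant 1. Concretely, the first
    equation turns the second into \<open>c\<^sup>2 * s False = 0\<close>.\<close>
  have "s True - a * s False = 0" "c * ((a\<^sup>2 + c\<^sup>2) * s False - a * s True) = 0"
    using s[of True] s[of False] c_pos by (simp_all add: UNIV_bool ck_def field_simps)
  then have "s True - a * s False = 0" "(a\<^sup>2 + c\<^sup>2) * s False - a * s True = 0"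
    using c_pos by simp_all
  then have 1: "s True = a * s False" and "c\<^sup>2 * s False = 0"
    by (simp_all add: power2_eq_square algebra_simps)
  then show "s i = 0"
    using c_pos by (cases i) auto
qed

end

section \<open>Identification of \<open>\<pp>\<close> with the tangent space at the base
  point\<close>

definition col :: "'m::{finite,zero} cmat \<times> 'k::{finite,zero} cmat \<Rightarrow> 'm cvec \<times> 'k cvec" where
  "col A = act A base_point"

text \<open>The skew-Hermitian matrix with prescribed first column and vanishing lower right block, so that
  \<open>lift\<close> inverts the identification of \<open>\<pp>\<close> with the tangent space at the base point.\<close>

definition lift1 :: "'m::{finite,zero} cvec \<Rightarrow> 'm cmat" where
  "lift1 h = (\<chi> r s. if s = 0 then (if r = 0 then \<i> * Im (h $ 0) else h $ r)
     else if r = 0 then - cnj (h $ s) else 0)"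

definition lift :: "'m::{finite,zero} cvec \<times> 'k::{finite,zero} cvec \<Rightarrow> 'm cmat \<times> 'k cmat" where
  "lift h = (lift1 (fst h), lift1 (snd h))"

lemma lift1_axis:
  "lift1 (axis 0 1) = 0" "lift1 (axis 0 \<i>) = Xvec"
  "\<nu> \<noteq> 0 \<Longrightarrow> lift1 (axis \<nu> 1) = Yodd \<nu>" "\<nu> \<noteq> 0 \<Longrightarrow> lift1 (axis \<nu> \<i>) = Yeven \<nu>"
  by (auto simp: vec_eq_iff lift1_def axis_def Xvec_def Yodd_def Yeven_def mscale_def map_matrix_def
      Tmat_def Zmat_def Emat_def)

lemma lift1_0: "lift1 0 = 0"
  by (simp add: lift1_def vec_eq_iff)

lemma linear_lift: "linear lift"
  by (rule linearI) (auto simp: lift_def lift1_def vec_eq_iff complex_eq_iff algebra_simps)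

lemma col_nth: "fst (col A) $ r = fst A $ r $ 0" "snd (col A) $ s = snd A $ s $ 0"
  by (simp_all add: col_def act_def base_point_def)

lemma linear_col: "linear col"
  by (rule linearI) (simp_all add: prod_eq_iff vec_eq_iff col_nth)

lemma col_generators:
  "col X1 = (axis 0 \<i>, 0)" "col X2 = (0, axis 0 \<i>)"
  "\<nu> \<noteq> 0 \<Longrightarrow> col (Yodd \<nu>, 0) = (axis \<nu> 1, 0)" "\<nu> \<noteq> 0 \<Longrightarrow> col (Yeven \<nu>, 0) = (axis \<nu> \<i>, 0)"
  "\<mu> \<noteq> 0 \<Longrightarrow> col (0, Yodd \<mu>) = (0, axis \<mu> 1)" "\<mu> \<noteq> 0 \<Longrightarrow> col (0, Yeven \<mu>) = (0, axis \<mu> \<i>)"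
  by (auto simp: prod_eq_iff vec_eq_iff col_nth X1_def X2_def axis_def Xvec_def Yodd_def Yeven_def
      mscale_def map_matrix_def Tmat_def Zmat_def Emat_def)

lemma lift_generators:
  "lift (axis 0 \<i>, 0) = X1" "lift (0, axis 0 \<i>) = X2"
  "\<nu> \<noteq> 0 \<Longrightarrow> lift (axis \<nu> 1, 0) = (Yodd \<nu>, 0)" "\<nu> \<noteq> 0 \<Longrightarrow> lift (axis \<nu> \<i>, 0) = (Yeven \<nu>, 0)"
  "\<mu> \<noteq> 0 \<Longrightarrow> lift (0, axis \<mu> 1) = (0, Yodd \<mu>)" "\<mu> \<noteq> 0 \<Longrightarrow> lift (0, axis \<mu> \<i>) = (0, Yeven \<mu>)"
  by (simp_all add: lift_def lift1_axis lift1_0 X1_def X2_def)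

lemma Ys_cases:
  assumes "Y \<in> Ys"
  obtains \<nu> where "\<nu> \<noteq> 0" "Y = (Yodd \<nu>, 0)" | \<nu> where "\<nu> \<noteq> 0" "Y = (Yeven \<nu>, 0)"
    | \<mu> where "\<mu> \<noteq> 0" "Y = (0, Yodd \<mu>)" | \<mu> where "\<mu> \<noteq> 0" "Y = (0, Yeven \<mu>)"
  using assms unfolding Ys_def by auto

lemma Ys_intros:
  "\<nu> \<noteq> 0 \<Longrightarrow> (Yodd \<nu>, 0) \<in> Ys" "\<nu> \<noteq> 0 \<Longrightarrow> (Yeven \<nu>, 0) \<in> Ys"
  "\<mu> \<noteq> 0 \<Longrightarrow> (0, Yodd \<mu>) \<in> Ys" "\<mu> \<noteq> 0 \<Longrightarrow> (0, Yeven \<mu>) \<in> Ys"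
  by (auto simp: Ys_def)

lemma lift_col:
  assumes "A \<in> \<pp>"
  shows "lift (col A) = A"
proof -
  have "linear (\<lambda>A. lift (col A))"
    using linear_compose[OF linear_col linear_lift] by (simp add: o_def)
  then show ?thesis
    by (rule linear_eq_on_span[OF _ linear_id[unfolded id_def] _ assms[unfolded \<pp>_def]])
      (auto simp: col_generators lift_generators elim!: Ys_cases)
qed

text \<open>By linearity it suffices to look at the standard real basis: each of its vectors is
  lifted to a generator of \<open>\<pp>\<close>, or to 0 if it is normal to a sphere at the base
  point.\<close>

lemma lift_in_\<pp>:
  fixes h :: "'m::{finite,zero} cvec \<times> 'k::{finite,zero} cvec"
  shows "lift h \<in> \<pp>"
proof -
  have "lift e \<in> \<pp>" if e: "e \<in> Basis" for e :: "'m cvec \<times> 'k cvec"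
  proof -
    have Y: "Y \<in> \<pp>" if "Y \<in> Ys" for Y :: "'m cmat \<times> 'k cmat"
      using that by (auto simp: \<pp>_def intro: span_base)
    note Y = Ys_intros[THEN Y]
    have X: "X1 \<in> (\<pp> :: ('m cmat \<times> 'k cmat) set)" "X2 \<in> (\<pp> :: ('m cmat \<times> 'k cmat) set)"
      by (auto simp: \<pp>_def intro: span_base)
    have 0: "lift (axis 0 1, 0) = (0 :: 'm cmat \<times> 'k cmat)" "lift (0, axis 0 1) = (0 :: 'm cmat \<times> 'k cmat)"
      by (simp_all add: lift_def lift1_axis lift1_0 zero_prod_def)
    have z: "0 \<in> (\<pp> :: ('m cmat \<times> 'k cmat) set)"
      by (simp add: \<pp>_def span_zero)
    from e consider (m) i b where "e = (axis i b, 0)" "b = 1 \<or> b = \<i>" | (k) i b where "e = (0, axis i b)" "b = 1 \<or> b = \<i>"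
      by (auto simp: Basis_prod_def Basis_vec_def Basis_complex_def)
    then show ?thesis
    proof cases
      case m
      then show ?thesis
        by (cases "i = 0") (auto simp: lift_generators X 0 z Y)
    next
      case k
      then show ?thesis
        by (cases "i = 0") (auto simp: lift_generators X 0 z Y)
    qed
  qed
  then show ?thesis
    unfolding linear_eq_sum_Basis[OF linear_lift, of h] \<pp>_def
    by (intro span_sum span_scale)
qed

lemma linear_act: "linear (act K)"
  by (rule linearI) (simp_all add: act_def vec_eq_iff matrix_vector_mult_def
      distrib_left sum.distrib scaleR_sum_right)

lemma act_cJ: "act K (cJ v) = cJ (act K v)"
  by (simp add: act_def cJ_def vec_eq_iff matrix_vector_mult_def sum_distrib_left mult_ac)

lemma act_cp: "act K (cp i v) = cp i (act K v)"
  by (simp add: act_def cp_def)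

lemma act_inner:
  assumes "K \<in> unitary_group \<times> unitary_group"
  shows "act K v \<bullet> act K w = v \<bullet> w"
  using assms by (auto simp: act_def inner_prod_def unitary_inner)

section \<open>The invariant structures as explicit tensor fields\<close>

context sphere_pair
begin

text \<open>The tensor field for \<open>I(a,c)\<close>: multiplication by the imaginary unit on
  horizontal vectors, encoded by \<open>B\<close>, and the prescribed matrix on the plane of the
  Hopf vectors.\<close>

definition \<I> :: "'m cvec \<times> 'k cvec \<Rightarrow> 'm cvec \<times> 'k cvec \<Rightarrow> 'm cvec \<times> 'k cvec" where
  "\<I> x v = (\<Sum>i\<in>UNIV. B i x v)
     + ((a * \<eta> True x v - (a\<^sup>2 + c\<^sup>2) * \<eta> False x v) / c) *\<^sub>R cJ (cp True x)
     + ((\<eta> True x v - a * \<eta> False x v) / c) *\<^sub>R cJ (cp False x)"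

abbreviation b :: "'m cvec \<times> 'k cvec" where
  "b \<equiv> base_point"

lemma M_eq: "M = sphere_product"
  by (auto simp: M_def sphere_product_def cp_def inner_prod_def dot_square_norm all_bool_eq abs_square_eq_1)

lemma b_M: "b \<in> M"
  by (simp add: M_eq sphere_product_def base_point_def norm_eq_sqrt_inner inner_axis_axis)

lemma T_b: "v \<in> T b \<longleftrightarrow> Re (fst v $ 0) = 0 \<and> Re (snd v $ 0) = 0"
  by (auto simp: T_def cp_def base_point_def inner_prod_def inner_axis inner_complex_def all_bool_eq)

lemma cJ_cp_b: "cJ (cp True b) = (axis 0 \<i>, 0)" "cJ (cp False b) = (0, axis 0 \<i>)"
  by (auto simp: cJ_def cp_def base_point_def vec_eq_iff axis_def)

lemma col_lift: "h \<in> T b \<Longrightarrow> col (lift h) = h"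
  by (auto simp: T_b prod_eq_iff vec_eq_iff col_nth lift_def lift1_def complex_eq_iff)

lemma linear_\<I>: "linear (\<I> x)"
  by (rule linearI) (simp_all add: \<I>_def UNIV_bool algebra_simps add_divide_distrib diff_divide_distrib)

lemma \<I>_horizontal:
  assumes "\<And>i. \<eta> i x v = 0" shows "\<I> x v = cJ v"
proof -
  have "(\<Sum>i\<in>UNIV. B i x v) = (\<Sum>i\<in>UNIV. cp i (cJ v))"
    by (simp add: B_def assms)
  then show ?thesis
    by (simp only: sum_p \<I>_def assms) simp
qed

lemma B_Jp:
  assumes "x \<in> M" shows "B i x (cJ (cp j x)) = 0"
  by (simp add: B_def \<eta>_Jp[OF assms])

lemma \<I>_Jp:
  assumes "x \<in> M"
  shows "\<I> x (cJ (cp True x)) = (a / c) *\<^sub>R cJ (cp True x) + (1 / c) *\<^sub>R cJ (cp False x)"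
    "\<I> x (cJ (cp False x)) = (- (a\<^sup>2 + c\<^sup>2) / c) *\<^sub>R cJ (cp True x) - (a / c) *\<^sub>R cJ (cp False x)"
  by (simp_all add: \<I>_def B_Jp[OF assms] \<eta>_Jp[OF assms])

lemma Ys_col:
  assumes "Y \<in> Ys"
  shows "col Y \<in> Basis" "\<eta> i b (col Y) = 0" "lift (col Y) = Y"
proof -
  have ax: "(axis \<nu> z, 0) \<in> (Basis :: ('m cvec \<times> 'k cvec) set)" "(0, axis \<mu> z) \<in> (Basis :: ('m cvec \<times> 'k cvec) set)"
    if "z = 1 \<or> z = \<i>" for z \<nu> \<mu>
    using that by (auto simp: Basis_prod_def Basis_vec_def Basis_complex_def)
  show "col Y \<in> Basis" "lift (col Y) = Y"
    using assms by (auto elim!: Ys_cases simp: col_generators lift_generators ax)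
  show "\<eta> i b (col Y) = 0"
    using assms
    by (cases i) (auto elim!: Ys_cases simp: \<eta>_def cJ_cp_b col_generators inner_prod_def inner_axis_axis)
qed

text \<open>\<open>I_p\<close> is a choice among linear maps with prescribed values on generators.
  The right-hand side meets the same conditions, so a choice exists and agrees with it on the span
  \<open>\<pp>\<close>.\<close>

lemma I_p_eq:
  assumes A: "A \<in> \<pp>"
  shows "I_p a c A = lift (\<I> b (col A))"
proof -
  let ?I = "\<lambda>A. lift (\<I> b (col A))"
  have lin: "linear ?I"
    using linear_compose[OF linear_col linear_compose[OF linear_\<I> linear_lift]] by (simp add: o_def)
  have h: "?I Y = lift (cJ (col Y))" if "Y \<in> Ys" for Y
    by (simp add: \<I>_horizontal Ys_col[OF that])
  have cJ_axis: "cJ (axis \<nu> z, 0) = (axis \<nu> (\<i> * z), 0)" "cJ (0, axis \<mu> z) = (0, axis \<mu> (\<i> * z))" for \<nu> :: 'm and \<mu> :: 'k and z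
    by (auto simp: cJ_def vec_eq_iff axis_def)
  have ax: "axis \<nu> (- 1) = - axis \<nu> (1::complex)" for \<nu> :: "'n::finite"
    by (auto simp: vec_eq_iff axis_def)
  have neg: "lift (- axis \<nu> 1, 0) = - lift (axis \<nu> 1, 0)" "lift (0, - axis \<mu> 1) = - lift (0, axis \<mu> 1)"
    for \<nu> :: 'm and \<mu> :: 'k
    by (simp_all flip: linear_neg[OF linear_lift])
  have spec: "linear ?I \<and>
     ?I X1 = (a / c) *\<^sub>R X1 + (1 / c) *\<^sub>R X2 \<and>
     ?I X2 = (- (a\<^sup>2 + c\<^sup>2) / c) *\<^sub>R X1 - (a / c) *\<^sub>R X2 \<and>
     (\<forall>\<nu>. \<nu> \<noteq> 0 \<longrightarrow> ?I (Yodd \<nu>, 0) = (Yeven \<nu>, 0) \<and> ?I (Yeven \<nu>, 0) = - (Yodd \<nu>, 0)) \<and>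
     (\<forall>\<mu>. \<mu> \<noteq> 0 \<longrightarrow> ?I (0, Yodd \<mu>) = (0, Yeven \<mu>) \<and> ?I (0, Yeven \<mu>) = - (0, Yodd \<mu>))"
  proof (intro conjI allI impI)
    show "?I X1 = (a / c) *\<^sub>R X1 + (1 / c) *\<^sub>R X2"
      using \<I>_Jp(1)[OF b_M]
      by (simp add: col_generators cJ_cp_b linear_add[OF linear_lift] linear_scale[OF linear_lift]
          lift_generators del: scaleR_Pair)
    show "?I X2 = (- (a\<^sup>2 + c\<^sup>2) / c) *\<^sub>R X1 - (a / c) *\<^sub>R X2"
      using \<I>_Jp(2)[OF b_M]
      by (simp add: col_generators cJ_cp_b linear_diff[OF linear_lift] linear_scale[OF linear_lift]
          lift_generators del: scaleR_Pair)
    show "?I (Yodd \<nu>, 0) = (Yeven \<nu>, 0)" "?I (Yeven \<nu>, 0) = - (Yodd \<nu>, 0)" if "\<nu> \<noteq> 0" for \<nu>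
      using h[OF Ys_intros(1)[OF that]] h[OF Ys_intros(2)[OF that]] that
      by (simp_all add: col_generators cJ_axis ax neg lift_generators)
    show "?I (0, Yodd \<mu>) = (0, Yeven \<mu>)" "?I (0, Yeven \<mu>) = - (0, Yodd \<mu>)" if "\<mu> \<noteq> 0" for \<mu>
      using h[OF Ys_intros(3)[OF that]] h[OF Ys_intros(4)[OF that]] that
      by (simp_all add: col_generators cJ_axis ax neg lift_generators)
  qed (rule lin)
  show ?thesis
  proof (rule linear_eq_on_span[OF _ lin _ A[unfolded \<pp>_def]])
    note P = someI[of "\<lambda>I. linear I \<and>
     I X1 = (a / c) *\<^sub>R X1 + (1 / c) *\<^sub>R X2 \<and>
     I X2 = (- (a\<^sup>2 + c\<^sup>2) / c) *\<^sub>R X1 - (a / c) *\<^sub>R X2 \<and>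
     (\<forall>\<nu>. \<nu> \<noteq> 0 \<longrightarrow> I (Yodd \<nu>, 0) = (Yeven \<nu>, 0) \<and> I (Yeven \<nu>, 0) = - (Yodd \<nu>, 0)) \<and>
     (\<forall>\<mu>. \<mu> \<noteq> 0 \<longrightarrow> I (0, Yodd \<mu>) = (0, Yeven \<mu>) \<and> I (0, Yeven \<mu>) = - (0, Yodd \<mu>))", OF spec,
     folded I_p_def]
    show "linear (I_p a c :: 'm cmat \<times> 'k cmat \<Rightarrow> _)"
      using P by (rule conjunct1)
    show "I_p a c Y = ?I Y" if "Y \<in> {X1, X2} \<union> Ys" for Y
      using that P spec by (auto elim!: Ys_cases)
  qed
qed

lemma g_p_eq:
  assumes "A \<in> \<pp>" "A' \<in> \<pp>"
  shows "g_p a c A A' = G b (col A) (col A')"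
proof -
  let ?g = "\<lambda>A A'. G b (col A) (col A')"
  have bil: "bilinear ?g"
  proof -
    have s: "G b (r *\<^sub>R v) w = r * G b v w" "G b w (r *\<^sub>R v) = r * G b w v" for r v w
      by (simp_all add: G_def algebra_simps sum_distrib_left)
    show ?thesis
      unfolding bilinear_def
      by (intro conjI allI linearI)
        (simp_all add: linear_add[OF linear_col] linear_scale[OF linear_col] G_add s)
  qed
  have h: "G b v (col Y) = v \<bullet> col Y" "G b (col Y) v = col Y \<bullet> v" if "Y \<in> Ys" for Y v
    using Ys_col(2)[OF that] by (simp_all add: G_def \<theta>_def) 
  have X: "col X1 = cJ (cp True b)" "col X2 = cJ (cp False b)"
    by (simp_all add: cJ_cp_b col_generators)
  have XY: "b \<bullet> cJ (cp i (col Y)) = 0" "col Y \<bullet> cJ (cp i b) = 0" if "Y \<in> Ys" for Y i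
    using Ys_col(2)[OF that, of i] by (simp_all add: \<eta>_def inner_Jp_commute[of b])
  \<comment> \<open>Distinct elements of \<open>Ys\<close> have distinct columns because
    \<open>lift\<close> recovers \<open>Y\<close> from \<open>col Y\<close>; orthonormality is then
    that of \<open>Basis\<close>.\<close>
  have YY: "col Y \<bullet> col Y' = (if Y = Y' then 1 else 0)" if "Y \<in> Ys" "Y' \<in> Ys" for Y Y' :: "'m cmat \<times> 'k cmat"
    using Ys_col(1,3)[OF that(1)] Ys_col(1,3)[OF that(2)] by (metis inner_Basis)
  have spec: "bilinear ?g \<and>
     ?g X1 X1 = 1 / c \<and> ?g X2 X2 = (a\<^sup>2 + c\<^sup>2) / c \<and> ?g X1 X2 = - a / c \<and> ?g X2 X1 = - a / c \<and>
     (\<forall>Y\<in>Ys. ?g X1 Y = 0 \<and> ?g Y X1 = 0 \<and> ?g X2 Y = 0 \<and> ?g Y X2 = 0) \<and>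
     (\<forall>Y\<in>Ys. \<forall>Y'\<in>Ys. ?g Y Y' = (if Y = Y' then 1 else 0))"
  proof (intro conjI ballI)
    show "?g X1 X1 = 1 / c" "?g X2 X2 = (a\<^sup>2 + c\<^sup>2) / c" "?g X1 X2 = - a / c" "?g X2 X1 = - a / c"
      using M_D[OF b_M]
      by (simp_all add: X G_def UNIV_bool \<eta>_Jp[OF b_M] \<theta>_Jp[OF b_M] ck_def)
  qed (use bil in \<open>simp_all add: h X XY YY\<close>)
  note P = someI[of "\<lambda>g. bilinear g \<and>
     g X1 X1 = 1 / c \<and> g X2 X2 = (a\<^sup>2 + c\<^sup>2) / c \<and> g X1 X2 = - a / c \<and> g X2 X1 = - a / c \<and>
     (\<forall>Y\<in>Ys. g X1 Y = 0 \<and> g Y X1 = 0 \<and> g X2 Y = 0 \<and> g Y X2 = 0) \<and>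
     (\<forall>Y\<in>Ys. \<forall>Y'\<in>Ys. g Y Y' = (if Y = Y' then 1 else 0))", OF spec, folded g_p_def]
  show ?thesis
  proof (rule bilinear_eq[OF conjunct1[OF P] bil order_refl order_refl])
    show "A \<in> span ({X1, X2} \<union> Ys)" "A' \<in> span ({X1, X2} \<union> Ys)"
      using assms by (simp_all add: \<pp>_def)
    show "g_p a c Y Y' = ?g Y Y'" if "Y \<in> {X1, X2} \<union> Ys" "Y' \<in> {X1, X2} \<union> Ys" for Y Y'
      using that P spec by auto
  qed
qed

text \<open>All these objects are built from the inner product, \<open>cJ\<close> and
  \<open>cp\<close>, which a pair of unitary matrices preserves or commutes with. This carries
  formulas at the base point to every point of \<open>M\<close>.\<close>

lemma act_equivariant:
  assumes K: "K \<in> unitary_group \<times> unitary_group"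
  shows "\<eta> i (act K x) (act K v) = \<eta> i x v" "G (act K x) (act K v) (act K w) = G x v w"
    "\<I> (act K x) (act K v) = act K (\<I> x v)" "act K v \<in> T (act K x) \<longleftrightarrow> v \<in> T x"
proof -
  show \<eta>: "\<eta> i (act K x) (act K v) = \<eta> i x v" for i v
    by (simp add: \<eta>_def act_inner[OF K] flip: act_cJ act_cp)
  show "G (act K x) (act K v) (act K w) = G x v w"
    by (simp add: G_def \<theta>_def \<eta> act_inner[OF K])
  have "B i (act K x) (act K v) = act K (B i x v)" for i
    by (simp add: B_def \<eta> linear_add[OF linear_act] linear_scale[OF linear_act] act_cJ act_cp del: p_J)
  then show "\<I> (act K x) (act K v) = act K (\<I> x v)"
    by (simp add: \<I>_def \<eta> linear_add[OF linear_act] linear_scale[OF linear_act] linear_sum[OF linear_act]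
        act_cJ act_cp del: p_J)
  show "act K v \<in> T (act K x) \<longleftrightarrow> v \<in> T x"
    by (simp add: T_def act_inner[OF K] flip: act_cp)
qed

lemma \<eta>_\<I>:
  assumes "x \<in> M" "v \<in> T x"
  shows "\<eta> True x (\<I> x v) = (a * \<eta> True x v - (a\<^sup>2 + c\<^sup>2) * \<eta> False x v) / c"
    "\<eta> False x (\<I> x v) = (\<eta> True x v - a * \<eta> False x v) / c"
  using assms by (simp_all add: \<I>_def \<eta>_B \<eta>_Jp)

lemma \<I>_T: "x \<in> M \<Longrightarrow> \<I> x v \<in> T x"
  by (simp add: \<I>_def subspace_add[OF subspace_T] subspace_sum[OF subspace_T]
      subspace_scale[OF subspace_T] B_T Jp_T)

lemma frame_exists:
  assumes x: "x \<in> M"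
  shows "\<exists>K\<in>unitary_group \<times> unitary_group. x = act K b"
proof -
  have "norm (fst x) = 1" "norm (snd x) = 1"
    using x by (auto simp: M_eq sphere_product_def)
  then obtain U V where "U \<in> unitary_group" "V \<in> unitary_group" "U *v axis 0 1 = fst x" "V *v axis 0 1 = snd x"
    using unitary_transitive by metis
  then show ?thesis
    by (intro bexI[of _ "(U, V)"]) (auto simp: act_def base_point_def prod_eq_iff)
qed

lemma element_exists:
  assumes K: "K \<in> unitary_group \<times> unitary_group" and v: "v \<in> T (act K b)"
  shows "\<exists>A\<in>\<pp>. v = act K (act A b)"
proof -
  obtain h1 h2 where "fst K *v h1 = fst v" "snd K *v h2 = snd v"
    using unitary_surj[of "fst K" "fst v"] unitary_surj[of "snd K" "snd v"] K by auto
  then have h: "act K (h1, h2) = v"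
    by (simp add: act_def)
  then have "(h1, h2) \<in> T b"
    using act_equivariant(4)[OF K, of "(h1, h2)" b] v by simp
  then have "col (lift (h1, h2)) = (h1, h2)"
    by (rule col_lift)
  then show ?thesis
    using lift_in_\<pp>[of "(h1, h2)"] h by (intro bexI[of _ "lift (h1, h2)"]) (simp_all add: col_def)
qed

text \<open>By equivariance every admissible \<open>K\<close> and \<open>A\<close> yields
  \<open>\<I> x v\<close>, which settles uniqueness in the definite description; existence is
  transitivity together with the surjectivity of the identification.\<close>

lemma cplx_structure_eq:
  assumes x: "x \<in> M" and v: "v \<in> T x"
  shows "cplx_structure a c x v = \<I> x v"
proof -
  have w: "act K (act (I_p a c A) b) = \<I> (act K b) (act K (act A b))"
    if "K \<in> unitary_group \<times> unitary_group" "A \<in> \<pp>" for K A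
    using that I_p_eq[OF that(2)] col_lift[OF \<I>_T[OF b_M]] act_equivariant(3)[OF that(1)]
    by (simp add: col_def)
  obtain K where K: "K \<in> unitary_group \<times> unitary_group" "x = act K b"
    using frame_exists[OF x] by blast
  obtain A where A: "A \<in> \<pp>" "v = act K (act A b)"
    using element_exists[OF K(1)] v K(2) by blast
  show ?thesis
    unfolding cplx_structure_def
  proof (rule the_equality)
    show "\<exists>K\<in>unitary_group \<times> unitary_group. \<exists>A\<in>\<pp>. x = act K b \<and> v = act K (act A b) \<and>
        \<I> x v = act K (act (I_p a c A) b)"
      using K A w[OF K(1) A(1)] by metis
  qed (use w in metis)
qed

lemma inv_metric_eq:
  assumes x: "x \<in> M" and v: "v \<in> T x" and w: "w \<in> T x"
  shows "inv_metric a c x v w = G x v w"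
proof -
  have g: "g_p a c A A' = G (act K b) (act K (act A b)) (act K (act A' b))"
    if "K \<in> unitary_group \<times> unitary_group" "A \<in> \<pp>" "A' \<in> \<pp>" for K A A'
    using that g_p_eq[OF that(2,3)] act_equivariant(2)[OF that(1)] by (simp add: col_def)
  obtain K where K: "K \<in> unitary_group \<times> unitary_group" "x = act K b"
    using frame_exists[OF x] by blast
  obtain A A' where A: "A \<in> \<pp>" "v = act K (act A b)" "A' \<in> \<pp>" "w = act K (act A' b)"
    using element_exists[OF K(1)] v w K(2) by meson
  show ?thesis
    unfolding inv_metric_def
  proof (rule the_equality)
    show "\<exists>K\<in>unitary_group \<times> unitary_group. \<exists>A\<in>\<pp>. \<exists>A'\<in>\<pp>. x = act K b \<and> v = act K (act A b) \<and>
        w = act K (act A' b) \<and> G x v w = g_p a c A A'"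
      using K A g[OF K(1) A(1,3)] by metis
  qed (use g in metis)
qed

end

section \<open>The Hermitian condition for the Ricci tensor of \<open>g(a,c)\<close>\<close>

context sphere_pair
begin

text \<open>Writing \<open>q\<close> as a pullback by \<open>B\<close> shows both that it vanishes
  on Hopf vectors and, with \<open>B_\<I>\<close>, that it is Hermitian.\<close>

lemma q_eq: "x \<in> M \<Longrightarrow> q i x v w = B i x v \<bullet> B i x w"
  using M_D[of x i]
  by (simp add: q_def B_def inner_left_distrib inner_right_distrib)
    (simp add: \<eta>_def inner_Jp_commute[of x i v] inner_Jp_commute[of x i w])

text \<open>\<open>B\<close> kills the Hopf part of \<open>\<I> x v\<close>, and on the remaining
  horizontal part it is multiplication by the imaginary unit.\<close>

lemma B_\<I>:
  assumes "x \<in> M" "v \<in> T x"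
  shows "B i x (\<I> x v) = cJ (B i x v)"
proof -
  have "B i x (B j x v) = (if i = j then cJ (B i x v) else 0)" for j
    by (simp add: B_def[of i x "B j x v"] p_B \<eta>_B[OF assms(2)])
  then have "B i x (\<Sum>j\<in>UNIV. B j x v) = cJ (B i x v)"
    by (cases i) (simp_all add: UNIV_bool)
  then show ?thesis
    by (simp add: \<I>_def B_Jp[OF assms(1)])
qed

lemma q_\<I>: "x \<in> M \<Longrightarrow> v \<in> T x \<Longrightarrow> w \<in> T x \<Longrightarrow> q i x (\<I> x v) (\<I> x w) = q i x v w"
  by (simp only: q_eq B_\<I> inner_J_J)

lemma d_eq: "d True = 2 * CARD('m)" "d False = 2 * CARD('k)"
proof -
  have sum: "(\<Sum>e\<in>(Basis :: ('m cvec \<times> 'k cvec) set). f e)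
      = (\<Sum>e\<in>Basis. f (e, 0)) + (\<Sum>e\<in>Basis. f (0, e))" for f :: "_ \<Rightarrow> real"
    unfolding Basis_prod_def
    by (subst sum.union_disjoint) (auto simp: sum.reindex inj_on_def)
  have "d True = (\<Sum>e\<in>(Basis :: 'm cvec set). 1)" "d False = (\<Sum>e\<in>(Basis :: 'k cvec set). 1)"
    unfolding d_def sum by (simp_all add: cp_def inner_prod_def del: sum_constant)
  then show "d True = 2 * CARD('m)" "d False = 2 * CARD('k)"
    by simp_all
qed

text \<open>The forms \<open>\<eta> i + \<theta> i\<close> are the \<open>G\<close>-duals of the
  Hopf vectors, so their coefficients are the rows of the matrix of \<open>g(a,c)\<close> on
  \<open>X1\<close>, \<open>X2\<close>.\<close>

lemma ricci_inv_metric: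
  assumes x: "x \<in> M" and v: "v \<in> T x" and w: "w \<in> T x"
  shows "ricci M (inv_metric a c) x v w =
      (d True - 2) * (\<eta> True x v - a * \<eta> False x v) * (\<eta> True x w - a * \<eta> False x w) / c\<^sup>2
    + (d False - 2) * ((a\<^sup>2 + c\<^sup>2) * \<eta> False x v - a * \<eta> True x v)
        * ((a\<^sup>2 + c\<^sup>2) * \<eta> False x w - a * \<eta> True x w) / c\<^sup>2
    + (\<Sum>i\<in>UNIV. (d i - 2 - 2 * ck a c i i) * q i x v w)"
proof -
  have "agrees (inv_metric a c)"
    by (simp add: agrees_def inv_metric_eq)
  note r = ricci_eq[OF this x v w]
  have "\<eta> True x u + \<theta> True x u = (\<eta> True x u - a * \<eta> False x u) / c"
    "\<eta> False x u + \<theta> False x u = ((a\<^sup>2 + c\<^sup>2) * \<eta> False x u - a * \<eta> True x u) / c" for u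
    using c_pos by (simp_all add: \<theta>_def UNIV_bool ck_def field_simps)
  then show ?thesis
    unfolding r by (simp add: UNIV_bool power2_eq_square)
qed

text \<open>Composition with \<open>\<I>\<close> turns each of the two forms into a multiple of a
  single \<open>\<eta>\<close>, with the indices exchanged; hence the simple shape of
  \<open>ricci_inv_metric_\<I>\<close>.\<close>

lemma Ricci_forms_\<I>:
  assumes "x \<in> M" "v \<in> T x"
  shows "\<eta> True x (\<I> x v) - a * \<eta> False x (\<I> x v) = - c * \<eta> False x v"
    "(a\<^sup>2 + c\<^sup>2) * \<eta> False x (\<I> x v) - a * \<eta> True x (\<I> x v) = c * \<eta> True x v"
  using c_pos by (simp_all add: \<eta>_\<I>[OF assms] field_simps power2_eq_square)

lemma ricci_inv_metric_\<I>:
  assumes x: "x \<in> M" and v: "v \<in> T x" and w: "w \<in> T x"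
  shows "ricci M (inv_metric a c) x (\<I> x v) (\<I> x w) =
      (d True - 2) * \<eta> False x v * \<eta> False x w + (d False - 2) * \<eta> True x v * \<eta> True x w
    + (\<Sum>i\<in>UNIV. (d i - 2 - 2 * ck a c i i) * q i x v w)"
  unfolding ricci_inv_metric[OF x \<I>_T[OF x] \<I>_T[OF x]] Ricci_forms_\<I>[OF x v] Ricci_forms_\<I>[OF x w]
    q_\<I>[OF x v w]
  using c_pos by (simp add: power2_eq_square)

text \<open>On a combination of Hopf vectors at the base point the terms with \<open>q\<close>
  vanish, and the Hermitian condition becomes one scalar identity in the coefficients
  \<open>s\<close>, \<open>t\<close>.\<close>

lemma hermitian_ricci_at_Hopf:
  assumes h: "hermitian_tensor M (cplx_structure a c) (ricci M (inv_metric a c))"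
  shows "(d True - 2) * t\<^sup>2 + (d False - 2) * s\<^sup>2
    = ((d True - 2) * (s - a * t)\<^sup>2 + (d False - 2) * ((a\<^sup>2 + c\<^sup>2) * t - a * s)\<^sup>2) / c\<^sup>2"
proof -
  define v where "v = s *\<^sub>R cJ (cp True b) + t *\<^sub>R cJ (cp False b)"
  have v: "v \<in> T b"
    by (simp add: v_def subspace_add[OF subspace_T] subspace_scale[OF subspace_T] Jp_T b_M)
  have \<eta>v: "\<eta> True b v = s" "\<eta> False b v = t"
    by (simp_all add: v_def \<eta>_Jp b_M)
  have q: "q i b v v = 0" for i
    by (simp add: q_eq b_M v_def B_Jp)
  have "ricci M (inv_metric a c) b (\<I> b v) (\<I> b v) = ricci M (inv_metric a c) b v v"
    using bspec[OF bspec[OF bspec[OF h[unfolded hermitian_tensor_def] b_M]], of v v] v b_M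
    by (simp add: tangent_space_M cplx_structure_eq)
  then show ?thesis
    by (simp add: ricci_inv_metric ricci_inv_metric_\<I> b_M v \<eta>v q power2_eq_square
        add_divide_distrib mult.assoc)
qed

end

theorem proposition4:
  fixes n p :: nat
  assumes "CARD('m::{finite,zero}) = n + 1" and "CARD('k::{finite,zero}) = p + 1"
    and "n \<noteq> 0 \<or> p \<noteq> 0"
  shows "(n = 0 \<or> p = 0 \<longrightarrow>
            \<not> (\<exists>a c. c > 0 \<and>
                 hermitian_tensor (sphere_product :: ('m cvec \<times> 'k cvec) set)
                   (cplx_structure a c) (ricci sphere_product (inv_metric a c)))) \<and>
         (n \<noteq> 0 \<and> p \<noteq> 0 \<longrightarrow>
            (\<forall>a c. a = 0 \<and> c = sqrt (real n / real p) \<longrightarrow>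
               hermitian_tensor (sphere_product :: ('m cvec \<times> 'k cvec) set)
                 (cplx_structure a c) (ricci sphere_product (inv_metric a c))))"
proof (intro conjI impI notI allI)
  assume np: "n = 0 \<or> p = 0"
  assume "\<exists>a c. c > 0 \<and> hermitian_tensor (sphere_product :: ('m cvec \<times> 'k cvec) set)
      (cplx_structure a c) (ricci sphere_product (inv_metric a c))"
  then obtain a c :: real where c: "c > 0"
    and h: "hermitian_tensor (sphere_product :: ('m cvec \<times> 'k cvec) set)
      (cplx_structure a c) (ricci sphere_product (inv_metric a c))"
    by blast
  interpret sphere_pair a c "TYPE('m)" "TYPE('k)"
    by unfold_locales (rule c)
  note H = hermitian_ricci_at_Hopf[unfolded M_eq, OF h, unfolded d_eq assms(1,2)]
  show False
  proof (cases "p = 0")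
    case True
    \<comment> \<open>Here \<open>d False = 2\<close>. Taking \<open>t = 1\<close> and
      \<open>s = a\<close> makes \<open>s - a * t\<close> vanish, so the right side is 0 while the
      left is \<open>2 * n\<close>.\<close>
    then show False
      using H[of 1 a] assms(3) c by simp
  next
    case False
    \<comment> \<open>Now \<open>n = 0\<close>, so \<open>d True = 2\<close>. Taking
      \<open>t = a\<close> and \<open>s = a\<^sup>2 + c\<^sup>2\<close> annihilates the other form,
      while the left side is \<open>2 * p * s\<^sup>2\<close>, which is positive.\<close>
    then show False
      using H[of a "a\<^sup>2 + c\<^sup>2"] np c by (simp add: mult.commute)
  qed
next
  fix a c :: real
  assume np: "n \<noteq> 0 \<and> p \<noteq> 0" and ac: "a = 0 \<and> c = sqrt (real n / real p)"
  then have a: "a = 0" and c: "c > 0" and c2: "c\<^sup>2 = real n / real p"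
    by simp_all
  interpret sphere_pair a c "TYPE('m)" "TYPE('k)"
    by unfold_locales (rule c)
  \<comment> \<open>For \<open>a = 0\<close> the Hermitian condition on the Hopf plane compares
    \<open>n / c\<^sup>2\<close> with \<open>p\<close> and \<open>c\<^sup>2 * p\<close> with
    \<open>n\<close>; both agree by this relation.\<close>
  have n: "real n = c\<^sup>2 * real p"
    using np c2 by simp
  show "hermitian_tensor (sphere_product :: ('m cvec \<times> 'k cvec) set)
      (cplx_structure a c) (ricci sphere_product (inv_metric a c))"
    unfolding hermitian_tensor_def M_eq[symmetric]
  proof (intro ballI)
    fix x v w assume x: "x \<in> M" and "v \<in> tangent_space M x" "w \<in> tangent_space M x"
    then have v: "v \<in> T x" and w: "w \<in> T x"
      by (simp_all add: tangent_space_M)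
    show "ricci M (inv_metric a c) x (cplx_structure a c x v) (cplx_structure a c x w)
        = ricci M (inv_metric a c) x v w"
      using c
      by (simp add: cplx_structure_eq ricci_inv_metric ricci_inv_metric_\<I> x v w d_eq assms(1,2))
        (simp add: a n power2_eq_square field_simps)
  qed
qed

end
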